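(* Let $\phi$ be a compactly supported contactomorphism of $(\mathbb{R}^{2n+1},\xi=\ker(dz-y\,dx))$ which is positive, i.e. $\phi$ is the time-1 map of a compactly supported contact isotopy generated by a contact Hamiltonian that is positive in the interior of its support (and $\phi\neq \mathrm{id}$). Then $\phi$ has infinitely many non-trivial, geometrically distinct iterated translated points; that is, there are infinitely many distinct points $q\in\mathbb{R}^{2n+1}$ such that, for some integer $k\geq 1$, $q$ is a translated point of $\phi^k$ with nonzero contact action $\mathcal{A}_{\phi^k}(q)\neq 0$.
   Context: Coordinates on $\mathbb{R}^{2n+1}$ are $(x,y,z)$ with $x,y\in\mathbb{R}^n$, $z\in\mathbb{R}$, and $y\,dx=\sum_i y_i\,dx_i$; the contact form is $\alpha=dz-y\,dx$, whose Reeb vector field is $\partial/\partial z$. For a contactomorphism $\psi$ let $g_\psi$ be the function with $\psi^*\alpha=e^{g_\psi}\alpha$. A point $q$ is a translated point of $\psi$ if $\psi(q)$ and $q$ lie on the same Reeb orbit (i.e. $\psi(q)$ has the same $x,y$ coordinates as $q$) and $g_\psi(q)=0$. An iterated translated point of $\phi$ is a translated point of some iterate $\phi^k$, $k\ge1$. Writing $\psi=(\psi_1,\psi_2,\psi_3)$ in $(x,y,z)$ components, the contact action of a translated point $q=(x,y,z)$ of $\psi$ is $\mathcal{A}_\psi(q)=\psi_3(q)-z$; the translated point is non-trivial if $\mathcal{A}_\psi(q)\neq0$ (in particular it lies in the interior of the support). *)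

theory Defs
  imports "HOL-Analysis.Analysis"
begin

text \<open>Points of R^(2n+1) are triples (x, y, z) with x, y in R^n (index type 'n), z real.\<close>
type_synonym 'n pt = "(real ^ 'n) \<times> (real ^ 'n) \<times> real"

text \<open>C-infinity smoothness between Euclidean spaces: differentiable everywhere and every
  directional derivative is again smooth (coinductively, i.e. derivatives of all orders).\<close>
coinductive smooth :: "('a::euclidean_space \<Rightarrow> 'b::real_normed_vector) \<Rightarrow> bool" where
  smoothI: "(\<forall>x. f differentiable (at x)) \<Longrightarrow> (\<forall>v. smooth (\<lambda>x. frechet_derivative f (at x) v))
            \<Longrightarrow> smooth f"

text \<open>The contact form alpha = dz - y dx evaluated at the point p on the tangent vector w.\<close>
definition alpha :: "'n::finite pt \<Rightarrow> 'n pt \<Rightarrow> real" where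
  "alpha p w = snd (snd w) - (fst (snd p)) \<bullet> (fst w)"

definition pullback_factor :: "('n::finite pt \<Rightarrow> 'n pt) \<Rightarrow> ('n pt \<Rightarrow> real) \<Rightarrow> bool" where
  "pullback_factor \<psi> g \<longleftrightarrow>
     (\<forall>q v. alpha (\<psi> q) (frechet_derivative \<psi> (at q) v) = exp (g q) * alpha q v)"

definition contactomorphism :: "('n::finite pt \<Rightarrow> 'n pt) \<Rightarrow> bool" where
  "contactomorphism \<psi> \<longleftrightarrow> bij \<psi> \<and> smooth \<psi> \<and> smooth (inv \<psi>) \<and>
     (\<exists>g. smooth g \<and> pullback_factor \<psi> g)"

definition gfun :: "('n::finite pt \<Rightarrow> 'n pt) \<Rightarrow> 'n pt \<Rightarrow> real" where
  "gfun \<psi> = (THE g. pullback_factor \<psi> g)"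

definition compactly_supported :: "('n::finite pt \<Rightarrow> 'n pt) \<Rightarrow> bool" where
  "compactly_supported \<psi> \<longleftrightarrow> compact (closure {q. \<psi> q \<noteq> q})"

definition translated_point :: "('n::finite pt \<Rightarrow> 'n pt) \<Rightarrow> 'n pt \<Rightarrow> bool" where
  "translated_point \<psi> q \<longleftrightarrow>
     fst (\<psi> q) = fst q \<and> fst (snd (\<psi> q)) = fst (snd q) \<and> gfun \<psi> q = 0"

definition contact_action :: "('n::finite pt \<Rightarrow> 'n pt) \<Rightarrow> 'n pt \<Rightarrow> real" where
  "contact_action \<psi> q = snd (snd (\<psi> q)) - snd (snd q)"

definition contact_isotopy :: "(real \<times> 'n::finite pt \<Rightarrow> 'n pt) \<Rightarrow> bool" where
  "contact_isotopy \<Phi> \<longleftrightarrow> smooth \<Phi> \<and> (\<forall>q. \<Phi> (0, q) = q) \<and>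
     (\<forall>t\<in>{0..1}. contactomorphism (\<lambda>q. \<Phi> (t, q))) \<and>
     (\<exists>K. compact K \<and> (\<forall>t\<in>{0..1}. \<forall>q. q \<notin> K \<longrightarrow> \<Phi> (t, q) = q))"

text \<open>The contact Hamiltonian generating Phi: H_t(Phi_t q) = alpha(d/dt Phi_t q).\<close>
definition contact_hamiltonian :: "(real \<times> 'n::finite pt \<Rightarrow> 'n pt) \<Rightarrow> real \<Rightarrow> 'n pt \<Rightarrow> real" where
  "contact_hamiltonian \<Phi> t p =
     alpha p (frechet_derivative \<Phi> (at (t, inv (\<lambda>q. \<Phi> (t, q)) p)) (1, 0))"

definition positive_contactomorphism :: "('n::finite pt \<Rightarrow> 'n pt) \<Rightarrow> bool" where
  "positive_contactomorphism \<phi> \<longleftrightarrow> \<phi> \<noteq> id \<and>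
     (\<exists>\<Phi>. contact_isotopy \<Phi> \<and> (\<forall>q. \<Phi> (1, q) = \<phi> q) \<and>
        (\<forall>t\<in>{0..1}. \<forall>p \<in> interior (closure {p. contact_hamiltonian \<Phi> t p \<noteq> 0}).
            contact_hamiltonian \<Phi> t p > 0))"

end

theory Submission
  imports Defs
begin

text \<open>
  A contactomorphism close to the identity, \<open>(x, y, z) \<mapsto> (X, Y, Z)\<close>, is encoded by the function
  \<open>f(x, Y, z) = Z - z - Y (X - x)\<close>, whose partial derivatives are \<open>Y - e y\<close>, \<open>x - X\<close> and \<open>e - 1\<close>
  with \<open>e\<close> the conformal factor; along a contact isotopy the time derivative of \<open>f\<close> is the contact
  Hamiltonian, so positivity of the isotopy gives \<open>f \<ge> 0\<close>. Cutting an isotopy of \<open>\<phi>\<^sup>k\<close> into short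
  pieces with functions \<open>f\<^sub>0, \<dots>\<close>, one considers broken loops \<open>(x\<^sub>j, Y\<^sub>j)\<close> with heights
  \<open>z\<^bsub>j+1\<^esub> = z\<^sub>j + Y\<^bsub>j+1\<^esub> (x\<^bsub>j+1\<^esub> - x\<^sub>j) + f\<^sub>j(x\<^sub>j, Y\<^bsub>j+1\<^esub>, z\<^sub>j)\<close>. The critical points of the
  total height \<open>G = z\<^sub>N - z\<^sub>0\<close> are the translated points of \<open>\<phi>\<^sup>k\<close>, and the critical value is the
  contact action. \<open>G\<close> is the quadratic form \<open>\<Sum> Y\<^bsub>j+1\<^esub> (x\<^bsub>j+1\<^esub> - x\<^sub>j)\<close> plus a nonnegative bounded term and
  satisfies the Palais-Smale condition at positive levels, so a linking argument gives a critical
  point with \<open>G > 0\<close>.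

  Hence every iterate has a non-trivial translated point. If there were only finitely many such
  points in total, each one occurring for infinitely many iterates would be periodic, because
  \<open>\<phi>\<^sup>k(q)\<close> is a translated point of \<open>\<phi>\<^bsup>l-k\<^esup>\<close> whenever \<open>q\<close> is one of \<open>\<phi>\<^sup>k\<close> and \<open>\<phi>\<^sup>l\<close>. A large
  common multiple \<open>k\<close> of the periods then leaves no non-trivial translated point for \<open>\<phi>\<^sup>k\<close>.
\<close>

section \<open>The Poincare-Miranda theorem in variable dimension\<close>

lemma tendsto_funI:
  fixes f :: "'b \<Rightarrow> 'i \<Rightarrow> 'a::topological_space"
  assumes "\<And>i. ((\<lambda>n. f n i) \<longlongrightarrow> l i) F"
  shows "(f \<longlongrightarrow> l) F"
proof -
  have "limitin (product_topology (\<lambda>i. euclidean) UNIV) f l F"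
    unfolding limitin_componentwise using assms by auto
  then show ?thesis
    by (simp add: euclidean_product_topology)
qed

lemma tendsto_funD:
  fixes f :: "'b \<Rightarrow> 'i \<Rightarrow> 'a::topological_space"
  assumes "(f \<longlongrightarrow> l) F"
  shows "((\<lambda>n. f n i) \<longlongrightarrow> l i) F"
proof -
  have "limitin (product_topology (\<lambda>i. euclidean) UNIV) f l F"
    using assms by (simp add: euclidean_product_topology)
  then show ?thesis
    unfolding limitin_componentwise by auto
qed

lemma compact_fun_box:
  fixes S :: "'i \<Rightarrow> 'a::topological_space set"
  assumes "\<And>i. compact (S i)"
  shows "compact {w. \<forall>i. w i \<in> S i}"
proof -
  have "compactin (product_topology (\<lambda>i. euclidean) UNIV) (PiE UNIV S)"
    unfolding compactin_PiE using assms by auto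
  moreover have "PiE UNIV S = {w. \<forall>i. w i \<in> S i}"
    by (auto simp: PiE_def)
  ultimately show ?thesis
    by (simp add: euclidean_product_topology)
qed

text \<open>Kuhn's combinatorial lemma on the grid of mesh \<open>1 / (m + 1)\<close> yields small
  cells on which every component of \<open>F\<close> changes sign; compactness of the cube and
  continuity turn these into a zero. Points are functions on all of \<open>nat\<close>, pinned to 0
  from index \<open>n\<close> on, so that the dimension is a number and not a type.\<close>

lemma poincare_miranda_unit:
  fixes F :: "(nat \<Rightarrow> real) \<Rightarrow> nat \<Rightarrow> real" and n :: nat
  defines "C \<equiv> {w. \<forall>i. if i < n then 0 \<le> w i \<and> w i \<le> 1 else w i = 0}"
  assumes cont: "\<And>i. i < n \<Longrightarrow> continuous_on C (\<lambda>w. F w i)"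
    and lo: "\<And>w i. w \<in> C \<Longrightarrow> i < n \<Longrightarrow> w i = 0 \<Longrightarrow> F w i \<le> 0"
    and hi: "\<And>w i. w \<in> C \<Longrightarrow> i < n \<Longrightarrow> w i = 1 \<Longrightarrow> F w i \<ge> 0"
  shows "\<exists>w\<in>C. \<forall>i<n. F w i = 0"
proof -
  define S :: "nat \<Rightarrow> real set" where "S i = (if i < n then {0..1} else {0})" for i
  have CS: "C = {w. \<forall>i. w i \<in> S i}"
    unfolding C_def S_def by (auto split: if_splits)
  have compC: "compact C"
    unfolding CS by (rule compact_fun_box) (auto simp: S_def)
  define pt :: "nat \<Rightarrow> (nat \<Rightarrow> nat) \<Rightarrow> nat \<Rightarrow> real"
    where "pt m x = (\<lambda>i. if i < n then real (x i) / real (Suc m) else 0)" for m x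
  have pt_in: "pt m x \<in> C" if "\<forall>i<n. x i \<le> Suc m" for m x
    using that unfolding pt_def C_def by (auto simp: divide_simps)
  \<comment> \<open>On the faces the label is prescribed as Kuhn's lemma demands; by
    \<open>lo\<close> and \<open>hi\<close> it still agrees there with the sign of \<open>F\<close>,
    which is what \<open>lab0\<close> and \<open>lab1\<close> record.\<close>
  define label :: "nat \<Rightarrow> (nat \<Rightarrow> nat) \<Rightarrow> nat \<Rightarrow> nat"
    where "label m x i = (if x i = 0 then 0 else if x i = Suc m then 1
                          else if F (pt m x) i \<le> 0 then 0 else 1)" for m x i
  have lab0: "F (pt m x) i \<le> 0" if "\<forall>i<n. x i \<le> Suc m" "i < n" "label m x i = 0" for m x i
    using that lo[OF pt_in[OF that(1)] that(2)] by (auto simp: label_def pt_def split: if_splits)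
  have lab1: "F (pt m x) i \<ge> 0" if "\<forall>i<n. x i \<le> Suc m" "i < n" "label m x i \<noteq> 0" for m x i
    using that hi[OF pt_in[OF that(1)] that(2)] by (auto simp: label_def pt_def split: if_splits)
  have ex: "\<exists>q. (\<forall>i<n. q i < Suc m) \<and> (\<forall>i<n. \<exists>r s. (\<forall>j<n. q j \<le> r j \<and> r j \<le> q j + 1)
        \<and> (\<forall>j<n. q j \<le> s j \<and> s j \<le> q j + 1) \<and> label m r i \<noteq> label m s i)" for m
  proof -
    have "\<forall>x. (\<forall>i<n. x i \<le> Suc m) \<longrightarrow> (\<forall>i<n. label m x i = 0 \<or> label m x i = 1)"
      "\<forall>x. (\<forall>i<n. x i \<le> Suc m) \<longrightarrow> (\<forall>i<n. x i = 0 \<longrightarrow> label m x i = 0)"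
      "\<forall>x. (\<forall>i<n. x i \<le> Suc m) \<longrightarrow> (\<forall>i<n. x i = Suc m \<longrightarrow> label m x i = 1)"
      by (auto simp: label_def)
    then show ?thesis
      by (rule kuhn_lemma[OF zero_less_Suc]) blast
  qed
  \<comment> \<open>\<open>w\<close> is the base corner of the cell; each coordinate
    \<open>i\<close> has its own pair \<open>r i\<close>, \<open>s i\<close> of corners of that
    cell, ordered by the sign of the \<open>i\<close>-th component.\<close>
  have ex2: "\<exists>w r s. w \<in> C \<and> (\<forall>i<n. r i \<in> C \<and> s i \<in> C \<and> F (r i) i \<le> 0 \<and> F (s i) i \<ge> 0 \<and>
       (\<forall>j. \<bar>r i j - w j\<bar> \<le> 1 / real (Suc m) \<and> \<bar>s i j - w j\<bar> \<le> 1 / real (Suc m)))" for m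
  proof -
    obtain q where q: "\<forall>i<n. q i < Suc m" and
      rs: "\<forall>i<n. \<exists>r s. (\<forall>j<n. q j \<le> r j \<and> r j \<le> q j + 1)
        \<and> (\<forall>j<n. q j \<le> s j \<and> s j \<le> q j + 1) \<and> label m r i \<noteq> label m s i"
      using ex by blast
    have close: "\<bar>pt m r j - pt m q j\<bar> \<le> 1 / real (Suc m)"
      if "\<forall>j<n. q j \<le> r j \<and> r j \<le> q j + 1" for r j
    proof (cases "j < n")
      case True
      then have "real (q j) \<le> real (r j)" "real (r j) \<le> real (q j) + 1"
        using that by (auto simp flip: of_nat_Suc)
      then show ?thesis
        using True by (auto simp: pt_def diff_divide_distrib[symmetric] divide_simps)
    qed (auto simp: pt_def)
    have "\<exists>r s. r \<in> C \<and> s \<in> C \<and> F r i \<le> 0 \<and> F s i \<ge> 0 \<and>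
       (\<forall>j. \<bar>r j - pt m q j\<bar> \<le> 1 / real (Suc m) \<and> \<bar>s j - pt m q j\<bar> \<le> 1 / real (Suc m))"
      if i: "i < n" for i
    proof -
      obtain r s where r: "\<forall>j<n. q j \<le> r j \<and> r j \<le> q j + 1"
        and s: "\<forall>j<n. q j \<le> s j \<and> s j \<le> q j + 1" and ne: "label m r i \<noteq> label m s i"
        using rs i by blast
      have rb: "\<forall>i<n. r i \<le> Suc m" and sb: "\<forall>i<n. s i \<le> Suc m"
      proof -
        have "v \<le> Suc m" if "v \<le> u + 1" "u < Suc m" for u v :: nat
          using that by simp
        then show "\<forall>i<n. r i \<le> Suc m" "\<forall>i<n. s i \<le> Suc m"
          using r s q by blast+
      qed
      consider "label m r i = 0" "label m s i \<noteq> 0" | "label m s i = 0" "label m r i \<noteq> 0"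
      proof -
        have "label m v i = 0 \<or> label m v i = 1" for v
          by (simp add: label_def)
        with ne show ?thesis
          using that by (metis zero_neq_one)
      qed
      then show ?thesis
      proof cases
        case 1
        then show ?thesis
          using lab0[OF rb i] lab1[OF sb i] pt_in[OF rb] pt_in[OF sb] close[OF r] close[OF s]
          by (intro exI[of _ "pt m r"] exI[of _ "pt m s"]) auto
      next
        case 2
        then show ?thesis
          using lab0[OF sb i] lab1[OF rb i] pt_in[OF rb] pt_in[OF sb] close[OF r] close[OF s]
          by (intro exI[of _ "pt m s"] exI[of _ "pt m r"]) auto
      qed
    qed
    then obtain r s where "\<forall>i<n. r i \<in> C \<and> s i \<in> C \<and> F (r i) i \<le> 0 \<and> F (s i) i \<ge> 0 \<and>
       (\<forall>j. \<bar>r i j - pt m q j\<bar> \<le> 1 / real (Suc m) \<and> \<bar>s i j - pt m q j\<bar> \<le> 1 / real (Suc m))"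
      by metis
    moreover have "pt m q \<in> C"
      using q by (intro pt_in) auto
    ultimately show ?thesis
      by blast
  qed
  obtain w r s where w: "\<And>m. w m \<in> C" and
    r: "\<And>m i. i < n \<Longrightarrow> r m i \<in> C \<and> F (r m i) i \<le> 0 \<and> (\<forall>j. \<bar>r m i j - w m j\<bar> \<le> 1 / real (Suc m))" and
    s: "\<And>m i. i < n \<Longrightarrow> s m i \<in> C \<and> F (s m i) i \<ge> 0 \<and> (\<forall>j. \<bar>s m i j - w m j\<bar> \<le> 1 / real (Suc m))"
    using ex2 by metis
  obtain l \<sigma> where l: "l \<in> C" and \<sigma>: "strict_mono \<sigma>" and lim: "(w \<circ> \<sigma>) \<longlonglongrightarrow> l"
    using compC w unfolding compact_eq_seq_compact_metric seq_compact_def by metis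
  have lim0: "(\<lambda>m. 1 / real (Suc (\<sigma> m))) \<longlonglongrightarrow> 0"
    using LIMSEQ_subseq_LIMSEQ[OF LIMSEQ_Suc[OF lim_1_over_n] \<sigma>] by (simp add: o_def)
  have near: "(\<lambda>m. v (\<sigma> m)) \<longlonglongrightarrow> l"
    if "\<And>m j. \<bar>v m j - w m j\<bar> \<le> 1 / real (Suc m)" for v
  proof (rule tendsto_funI)
    fix j
    have "(\<lambda>m. v (\<sigma> m) j - w (\<sigma> m) j) \<longlonglongrightarrow> 0"
      by (rule Lim_null_comparison[OF _ lim0]) (use that in auto)
    moreover have "(\<lambda>m. w (\<sigma> m) j) \<longlonglongrightarrow> l j"
      using tendsto_funD[OF lim] by simp
    ultimately show "(\<lambda>m. v (\<sigma> m) j) \<longlonglongrightarrow> l j"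
      using tendsto_add by fastforce
  qed
  have "F l i = 0" if i: "i < n" for i
  proof -
    have "(\<lambda>m. F (r (\<sigma> m) i) i) \<longlonglongrightarrow> F l i"
      by (rule continuous_on_tendsto_compose[OF cont[OF i] near]) (use r i l in auto)
    then have 1: "F l i \<le> 0"
      by (rule tendsto_upperbound) (use r i in auto)
    have "(\<lambda>m. F (s (\<sigma> m) i) i) \<longlonglongrightarrow> F l i"
      by (rule continuous_on_tendsto_compose[OF cont[OF i] near]) (use s i l in auto)
    then have "F l i \<ge> 0"
      by (rule tendsto_lowerbound) (use s i in auto)
    with 1 show ?thesis by simp
  qed
  with l show ?thesis by blast
qed

text \<open>An enumeration of \<open>I\<close> and an affine map from \<open>[0, 1]\<close> to
  \<open>[-R, R]\<close> reduce this to the unit cube. In the linking argument the indices are pairs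
  of a corner and a component, plus one extra index.\<close>

lemma poincare_miranda:
  fixes F :: "('i \<Rightarrow> real) \<Rightarrow> 'i \<Rightarrow> real"
  assumes fin: "finite I" and R: "R > 0"
    and cont: "\<And>i. i \<in> I \<Longrightarrow> continuous_on UNIV (\<lambda>w. F w i)"
    and lo: "\<And>w i. i \<in> I \<Longrightarrow> (\<And>k. \<bar>w k\<bar> \<le> R) \<Longrightarrow> w i = - R \<Longrightarrow> F w i \<le> 0"
    and hi: "\<And>w i. i \<in> I \<Longrightarrow> (\<And>k. \<bar>w k\<bar> \<le> R) \<Longrightarrow> w i = R \<Longrightarrow> F w i \<ge> 0"
  shows "\<exists>w. (\<forall>k. \<bar>w k\<bar> \<le> R) \<and> (\<forall>i\<in>I. F w i = 0)"
proof -
  define n where "n = card I"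
  obtain b where b: "bij_betw b {..<n} I"
    using ex_bij_betw_nat_finite[OF fin] unfolding n_def atLeast0LessThan by blast
  define c where "c = inv_into {..<n} b"
  have c: "c i < n" "b (c i) = i" if "i \<in> I" for i
    using that b bij_betw_inv_into[OF b] bij_betw_inv_into_right[OF b]
    unfolding c_def bij_betw_def by auto
  have cb: "c (b k) = k" "b k \<in> I" if "k < n" for k
    using that b bij_betw_inv_into_left[OF b] unfolding c_def bij_betw_def by auto
  define g :: "(nat \<Rightarrow> real) \<Rightarrow> 'i \<Rightarrow> real"
    where "g w = (\<lambda>i. if i \<in> I then R * (2 * w (c i) - 1) else 0)" for w
  have gcont: "continuous_on A g" for A
  proof (rule continuous_on_coordinatewise_then_product)
    fix i
    show "continuous_on A (\<lambda>w. g w i)"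
      by (cases "i \<in> I") (auto simp: g_def intro!: continuous_intros
            continuous_on_subset[OF continuous_on_product_coordinates])
  qed
  let ?C = "{w :: nat \<Rightarrow> real. \<forall>i. if i < n then 0 \<le> w i \<and> w i \<le> 1 else w i = 0}"
  have gb: "\<bar>g w k\<bar> \<le> R" if "w \<in> ?C" for w k
  proof (cases "k \<in> I")
    case True
    then have "0 \<le> w (c k)" "w (c k) \<le> 1"
      using that c[OF True] by (auto dest!: spec[of _ "c k"])
    then have "\<bar>2 * w (c k) - 1\<bar> \<le> 1" by auto
    then have "R * \<bar>2 * w (c k) - 1\<bar> \<le> R"
      using R by (simp add: mult_left_le)
    then show ?thesis using True R by (simp add: g_def abs_mult)
  qed (use R in \<open>auto simp: g_def\<close>)
  have "\<exists>w\<in>?C. \<forall>k<n. F (g w) (b k) = 0"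
  proof (rule poincare_miranda_unit)
    fix k assume "k < n"
    then show "continuous_on ?C (\<lambda>w. F (g w) (b k))"
      using continuous_on_compose2[OF cont gcont, of "b k"] cb by auto
  next
    fix w k assume "w \<in> ?C" "k < n" "w k = 0"
    then show "F (g w) (b k) \<le> 0"
      using gb cb by (intro lo) (auto simp: g_def)
  next
    fix w k assume "w \<in> ?C" "k < n" "w k = 1"
    then show "F (g w) (b k) \<ge> 0"
      using gb cb by (intro hi) (auto simp: g_def)
  qed
  then obtain w where "w \<in> ?C" "\<forall>k<n. F (g w) (b k) = 0" by blast
  then show ?thesis
    using gb c by (intro exI[of _ "g w"]) force
qed

section \<open>The height functional on broken loops\<close>

text \<open>A node of a closed loop is the end of one step and the start of the next; this
  reindexing brings both occurrences to the same index. The predecessor is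
  \<open>(j + N - 1) mod N\<close> because subtraction on \<open>nat\<close> truncates at 0.\<close>

lemma sum_cyclic_shift:
  fixes g :: "nat \<Rightarrow> nat \<Rightarrow> 'a::comm_monoid_add"
  assumes "0 < N"
  shows "(\<Sum>j<N. g j (Suc j mod N)) = (\<Sum>j<N. g ((j + N - 1) mod N) j)"
proof -
  obtain M where M: "N = Suc M" using assms by (cases N) auto
  have pred: "Suc (j + M) mod Suc M = j" if "j < M" for j
    using that mod_add_self2[of j "Suc M"] by simp
  have "(\<Sum>j<N. g j (Suc j mod N)) = (\<Sum>j<M. g j (Suc j)) + g M 0"
    unfolding M by (auto intro!: sum.cong)
  also have "\<dots> = g M 0 + (\<Sum>j<M. g ((Suc j + N - 1) mod N) (Suc j))"
    unfolding M by (auto simp: add.commute[of _ "g M 0"] pred intro!: arg_cong2[of _ _ _ _ "(+)"] sum.cong)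
  also have "\<dots> = (\<Sum>j<N. g ((j + N - 1) mod N) j)"
    unfolding M sum.lessThan_Suc_shift by simp
  finally show ?thesis .
qed

text \<open>Spreads a bound known at a single corner to all corners, in either direction along the
  chain.\<close>

lemma norm_chain:
  fixes g :: "nat \<Rightarrow> 'a::real_normed_vector" and N i j :: nat and D :: real
  assumes step: "\<And>i. i < N \<Longrightarrow> norm (g (Suc i) - g i) \<le> D" and "i \<le> N" "j \<le> N" "0 \<le> D"
  shows "norm (g i) \<le> norm (g j) + N * D"
proof -
  have *: "norm (g (i + k) - g i) \<le> k * D" if "i + k \<le> N" for i k :: nat
    using that
  proof (induction k)
    case (Suc k)
    have "norm (g (i + Suc k) - g i) \<le> norm (g (Suc (i + k)) - g (i + k)) + norm (g (i + k) - g i)"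
      using norm_triangle_ineq[of "g (Suc (i + k)) - g (i + k)" "g (i + k) - g i"] by simp
    also have "\<dots> \<le> D + k * D"
      using Suc step[of "i + k"] by (intro add_mono) auto
    finally show ?case by (simp add: algebra_simps)
  qed simp
  have mono: "k * D \<le> N * D" if "k \<le> N" for k :: nat
    using that assms(4) by (simp add: mult_right_mono)
  have "norm (g i - g j) \<le> N * D"
  proof (cases "j \<le> i")
    case True
    then show ?thesis
      using order_trans[OF *[of j "i - j"] mono[of "i - j"]] assms by auto
  next
    case False
    then show ?thesis
      using order_trans[OF *[of i "j - i"] mono[of "j - i"]] assms by (auto simp: norm_minus_commute)
  qed
  then show ?thesis
    using norm_triangle_ineq2[of "g i" "g j"] by linarith
qed

text \<open>The entries of a broken loop are the points \<open>x\<^sub>j\<close>, the momenta \<open>Y\<^bsub>j+1\<^esub>\<close> (stored at index \<open>j\<close>)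
  and the initial height. The number \<open>N\<close> of corners is not fixed by the type: only the indices
  \<open>j < N\<close> matter.\<close>
type_synonym 'n broken = "(nat \<Rightarrow> real ^ 'n) \<times> (nat \<Rightarrow> real ^ 'n) \<times> real"

text \<open>All indices are bounded, including those beyond the corners in use, which makes the set
  compact in the product topology.\<close>

definition cube :: "real \<Rightarrow> 'n::finite broken set" where
  "cube r = {x. \<forall>j. x j \<in> cball 0 r} \<times> {y. \<forall>j. y j \<in> cball 0 r} \<times> {-r..r}"

text \<open>Straight lines in the space of broken loops; the functional is only ever differentiated
  along them.\<close>

definition shift :: "'n::finite broken \<Rightarrow> 'n broken \<Rightarrow> real \<Rightarrow> 'n broken" where
  "shift u v t = (\<lambda>j. fst u j + t *\<^sub>R fst v j, \<lambda>j. fst (snd u) j + t *\<^sub>R fst (snd v) j,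
                  snd (snd u) + t * snd (snd v))"

lemma shift_0 [simp]: "shift u v 0 = u"
  by (simp add: shift_def)

lemma compact_cube: "compact (cube r)"
  unfolding cube_def by (intro compact_Times compact_fun_box) auto

lemma shift_in_cube:
  assumes "u \<in> cube r" "v \<in> cube 1" "\<bar>t\<bar> \<le> s"
  shows "shift u v t \<in> cube (r + s)"
proof -
  have *: "norm (p + t *\<^sub>R q) \<le> r + s" if "norm p \<le> r" "norm q \<le> 1" for p q :: "real ^ 'n"
  proof -
    have "norm (p + t *\<^sub>R q) \<le> norm p + \<bar>t\<bar> * norm q"
      using norm_triangle_ineq[of p "t *\<^sub>R q"] by simp
    also have "\<bar>t\<bar> * norm q \<le> s * 1"
      using that assms(3) by (intro mult_mono) auto
    finally show ?thesis using that by simp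
  qed
  have "\<bar>t * snd (snd v)\<bar> \<le> s * 1"
    unfolding abs_mult using assms by (intro mult_mono) (auto simp: cube_def)
  then show ?thesis
    using assms * unfolding cube_def shift_def by (auto simp: mem_Times_iff)
qed

lemma continuous_on_broken:
  assumes "continuous_on A U"
  shows "continuous_on A (\<lambda>t. fst (U t :: 'n::finite broken) j)"
    "continuous_on A (\<lambda>t. fst (snd (U t)) j)" "continuous_on A (\<lambda>t. snd (snd (U t)))"
proof -
  show "continuous_on A (\<lambda>t. fst (U t) j)"
    by (rule continuous_on_product_then_coordinatewise) (intro continuous_intros assms)
  show "continuous_on A (\<lambda>t. fst (snd (U t)) j)"
    by (rule continuous_on_product_then_coordinatewise) (intro continuous_intros assms)
  show "continuous_on A (\<lambda>t. snd (snd (U t)))"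
    by (intro continuous_intros assms)
qed

lemma continuous_on_shift:
  assumes "continuous_on A u" "continuous_on A v" "continuous_on A t"
  shows "continuous_on A (\<lambda>a. shift (u a) (v a) (t a))"
  unfolding shift_def
  by (intro continuous_on_Pair continuous_on_coordinatewise_then_product continuous_on_add
      continuous_on_scaleR continuous_on_mult continuous_on_broken assms)

text \<open>\<open>f j\<close> plays the generating function of the \<open>j\<close>-th short piece,
  with \<open>a j\<close>, \<open>b j\<close>, \<open>c j\<close> its partial derivatives in x, Y
  and z. In this reading \<open>1 + c j\<close> is the conformal factor of the piece, whence
  \<open>c_pos\<close>.\<close>

locale chain =
  fixes f c :: "nat \<Rightarrow> 'n::finite pt \<Rightarrow> real" and a b :: "nat \<Rightarrow> 'n pt \<Rightarrow> real ^ 'n"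
    and N :: nat and K :: "'n pt set"
  assumes N: "0 < N"
    and deriv: "\<And>j p. (f j has_derivative
       (\<lambda>v. a j p \<bullet> fst v + b j p \<bullet> fst (snd v) + c j p * snd (snd v))) (at p)"
    and cont_a: "\<And>j. continuous_on UNIV (a j)"
    and cont_b: "\<And>j. continuous_on UNIV (b j)"
    and cont_c: "\<And>j. continuous_on UNIV (c j)"
    and compact_K: "compact K"
    and supp: "\<And>j p. p \<notin> K \<Longrightarrow> f j p = 0"
    and nonneg: "\<And>j p. 0 \<le> f j p"
    and c_pos: "\<And>j p. 0 < 1 + c j p"
    and nontrivial: "\<exists>j<N. \<exists>p. f j p \<noteq> 0"
begin

lemma cont_f: "continuous_on UNIV (f j)"
  by (rule continuous_at_imp_continuous_on) (rule ballI, rule has_derivative_continuous[OF deriv])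

lemma supp_deriv:
  assumes "p \<notin> K"
  shows "a j p = 0" "b j p = 0" "c j p = 0"
proof -
  have "(f j has_derivative (\<lambda>v. 0)) (at p)"
    by (rule has_derivative_transform_within_open[of "\<lambda>_. 0" _ _ _ "- K"])
       (use assms compact_K supp in \<open>auto simp: compact_imp_closed open_Compl\<close>)
  then have *: "(\<lambda>v. a j p \<bullet> fst v + b j p \<bullet> fst (snd v) + c j p * snd (snd v)) = (\<lambda>v. 0)"
    by (rule has_derivative_unique[OF deriv])
  show "a j p = 0" "b j p = 0" "c j p = 0"
    using fun_cong[OF *, of "(a j p, 0, 0)"] fun_cong[OF *, of "(0, b j p, 0)"]
      fun_cong[OF *, of "(0, 0, 1)"] by auto
qed

primrec height :: "'n broken \<Rightarrow> nat \<Rightarrow> real" where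
  "height u 0 = snd (snd u)"
| "height u (Suc j) = height u j + fst (snd u) j \<bullet> (fst u (Suc j mod N) - fst u j)
     + f j (fst u j, fst (snd u) j, height u j)"

definition P :: "'n broken \<Rightarrow> nat \<Rightarrow> 'n pt" where
  "P u j = (fst u j, fst (snd u) j, height u j)"

definition G :: "'n broken \<Rightarrow> real" where
  "G u = height u N - height u 0"

text \<open>The derivative of the final height with respect to the height at corner
  \<open>j\<close>: step \<open>i\<close> multiplies a change of height by
  \<open>1 + c i\<close>.\<close>

definition lam :: "'n broken \<Rightarrow> nat \<Rightarrow> real" where
  "lam u j = (\<Prod>i\<in>{j..<N}. 1 + c i (P u i))"

text \<open>The partial gradient of \<open>G\<close> in the node \<open>j\<close>, which is the end
  of step \<open>j - 1\<close> (weight \<open>lam u j\<close>) and the start of step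
  \<open>j\<close> (weight \<open>lam u (Suc j)\<close>). Node 0 ends the last step, whose weight is
  1.\<close>

definition gx :: "'n broken \<Rightarrow> nat \<Rightarrow> real ^ 'n" where
  "gx u j = (if j = 0 then 1 else lam u j) *\<^sub>R fst (snd u) ((j + N - 1) mod N)
     + lam u (Suc j) *\<^sub>R (a j (P u j) - fst (snd u) j)"

definition gy :: "'n broken \<Rightarrow> nat \<Rightarrow> real ^ 'n" where
  "gy u j = lam u (Suc j) *\<^sub>R (fst u (Suc j mod N) - fst u j + b j (P u j))"

definition gz :: "'n broken \<Rightarrow> real" where
  "gz u = lam u 0 - 1"

definition dG :: "'n broken \<Rightarrow> 'n broken \<Rightarrow> real" where
  "dG u v = (\<Sum>j<N. gx u j \<bullet> fst v j + gy u j \<bullet> fst (snd v) j) + gz u * snd (snd v)"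

definition S :: "'n broken \<Rightarrow> real" where
  "S u = (\<Sum>j<N. (norm (gx u j))\<^sup>2 + (norm (gy u j))\<^sup>2) + (gz u)\<^sup>2"

text \<open>The gradient divided by \<open>1 + S u\<close>, which keeps every entry within norm 1.
  It points uphill and is followed with negative time.\<close>

definition descent :: "'n broken \<Rightarrow> 'n broken" where
  "descent u = (\<lambda>j. if j < N then gx u j /\<^sub>R (1 + S u) else 0,
           \<lambda>j. if j < N then gy u j /\<^sub>R (1 + S u) else 0, gz u / (1 + S u))"

lemma height_eq: "height u j = height u 0 + (\<Sum>i<j. fst (snd u) i \<bullet> (fst u (Suc i mod N) - fst u i)) + (\<Sum>i<j. f i (P u i))"
  by (induction j) (auto simp: P_def)

lemma G_eq: "G u = (\<Sum>i<N. fst (snd u) i \<bullet> (fst u (Suc i mod N) - fst u i)) + (\<Sum>i<N. f i (P u i))"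
  unfolding G_def height_eq[of u N] by simp

lemma S_nonneg: "0 \<le> S u"
  unfolding S_def by (intro add_nonneg_nonneg sum_nonneg) auto

lemma S_bounds:
  assumes "j < N"
  shows "(norm (gx u j))\<^sup>2 \<le> S u" "(norm (gy u j))\<^sup>2 \<le> S u"
proof -
  have "(norm (gx u j))\<^sup>2 + (norm (gy u j))\<^sup>2 \<le> (\<Sum>j<N. (norm (gx u j))\<^sup>2 + (norm (gy u j))\<^sup>2)"
    using assms by (intro member_le_sum[where f="\<lambda>j. (norm (gx u j))\<^sup>2 + (norm (gy u j))\<^sup>2"]) auto
  then show "(norm (gx u j))\<^sup>2 \<le> S u" "(norm (gy u j))\<^sup>2 \<le> S u"
    unfolding S_def by (smt (verit) zero_le_power2)+
qed

lemma S_bound_gz: "(gz u)\<^sup>2 \<le> S u"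
  unfolding S_def using sum_nonneg[of "{..<N}" "\<lambda>j. (norm (gx u j))\<^sup>2 + (norm (gy u j))\<^sup>2"] by auto

lemma lam_pos: "0 < lam u j"
  unfolding lam_def using c_pos by (intro prod_pos) auto

lemma lam_N: "lam u N = 1"
  by (simp add: lam_def)

lemma lam_Suc: "j < N \<Longrightarrow> lam u j = (1 + c j (P u j)) * lam u (Suc j)"
  unfolding lam_def by (simp add: prod.atLeast_Suc_lessThan)

lemma continuous_height: "continuous_on A U \<Longrightarrow> continuous_on A (\<lambda>t. height (U t) j)"
proof (induction j)
  case (Suc j)
  then show ?case
    by (auto intro!: continuous_intros continuous_on_broken continuous_on_compose2[OF cont_f])
qed (auto intro: continuous_on_broken)

lemma continuous_P: "continuous_on A U \<Longrightarrow> continuous_on A (\<lambda>t. P (U t) j)"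
  unfolding P_def by (intro continuous_intros continuous_on_broken continuous_height)

lemma continuous_lam: "continuous_on A U \<Longrightarrow> continuous_on A (\<lambda>t. lam (U t) j)"
  unfolding lam_def
  by (intro continuous_intros continuous_on_compose2[OF cont_c continuous_P]) auto

lemma continuous_gx: "continuous_on A U \<Longrightarrow> continuous_on A (\<lambda>t. gx (U t) j)"
  unfolding gx_def
  by (cases "j = 0") (auto intro!: continuous_intros continuous_on_compose2[OF cont_a continuous_P]
    continuous_lam continuous_on_broken)

lemma continuous_gy: "continuous_on A U \<Longrightarrow> continuous_on A (\<lambda>t. gy (U t) j)"
  unfolding gy_def
  by (intro continuous_intros continuous_on_compose2[OF cont_b continuous_P]
    continuous_lam continuous_on_broken) auto

lemma continuous_gz: "continuous_on A U \<Longrightarrow> continuous_on A (\<lambda>t. gz (U t))"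
  unfolding gz_def by (intro continuous_intros continuous_lam)

lemma continuous_G: "continuous_on A U \<Longrightarrow> continuous_on A (\<lambda>t. G (U t))"
  unfolding G_def by (intro continuous_intros continuous_height)

lemma continuous_S: "continuous_on A U \<Longrightarrow> continuous_on A (\<lambda>t. S (U t))"
  unfolding S_def by (intro continuous_intros continuous_gx continuous_gy continuous_gz)

lemma continuous_dG:
  "continuous_on A U \<Longrightarrow> continuous_on A V \<Longrightarrow> continuous_on A (\<lambda>t. dG (U t) (V t))"
  unfolding dG_def
  by (intro continuous_intros continuous_gx continuous_gy continuous_gz continuous_on_broken)

lemma continuous_descent: "continuous_on A U \<Longrightarrow> continuous_on A (\<lambda>t. descent (U t))"
proof -
  assume U: "continuous_on A U"
  have nz: "1 + S u \<noteq> 0" for u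
    using S_nonneg[of u] by linarith
  have "continuous_on A (\<lambda>t. if j < N then gx (U t) j /\<^sub>R (1 + S (U t)) else 0)"
     "continuous_on A (\<lambda>t. if j < N then gy (U t) j /\<^sub>R (1 + S (U t)) else 0)" for j
    by (cases "j < N"; auto intro!: continuous_intros continuous_gx continuous_gy continuous_S U nz)+
  then show ?thesis
    unfolding descent_def
    by (auto intro!: continuous_intros continuous_gz continuous_S U nz)
qed

section \<open>First variation of the height functional\<close>

primrec dheight :: "'n broken \<Rightarrow> 'n broken \<Rightarrow> nat \<Rightarrow> real" where
  "dheight u v 0 = snd (snd v)"
| "dheight u v (Suc j) = (1 + c j (P u j)) * dheight u v j
     + fst (snd u) j \<bullet> (fst v (Suc j mod N) - fst v j)
     + fst (snd v) j \<bullet> (fst u (Suc j mod N) - fst u j)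
     + a j (P u j) \<bullet> fst v j + b j (P u j) \<bullet> fst (snd v) j"

lemma height_deriv:
  "((\<lambda>t. height (shift u v t) j) has_real_derivative dheight (shift u v t) v j) (at t)"
proof (induction j)
  case 0
  show ?case
    unfolding shift_def by (auto intro!: derivative_eq_intros)
next
  case (Suc j)
  have 1: "((\<lambda>t. P (shift u v t) j) has_derivative
      (\<lambda>h. (h *\<^sub>R fst v j, h *\<^sub>R fst (snd v) j, h *\<^sub>R dheight (shift u v t) v j))) (at t)"
    unfolding P_def using Suc.IH
    by (intro has_derivative_Pair) (auto simp: shift_def has_field_derivative_def mult_commute_abs
        mult.commute intro!: derivative_eq_intros)
  have 2: "((\<lambda>t. f j (P (shift u v t) j)) has_real_derivative
      (a j (P (shift u v t) j) \<bullet> fst v j + b j (P (shift u v t) j) \<bullet> fst (snd v) j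
        + c j (P (shift u v t) j) * dheight (shift u v t) v j)) (at t)"
    unfolding has_field_derivative_def
    by (rule has_derivative_eq_rhs[OF has_derivative_compose[OF 1 deriv]])
       (simp add: fun_eq_iff algebra_simps)
  have 3: "((\<lambda>t. fst (snd (shift u v t)) j \<bullet> (fst (shift u v t) (Suc j mod N) - fst (shift u v t) j))
     has_real_derivative (fst (snd (shift u v t)) j \<bullet> (fst v (Suc j mod N) - fst v j)
     + fst (snd v) j \<bullet> (fst (shift u v t) (Suc j mod N) - fst (shift u v t) j))) (at t)"
    unfolding shift_def has_field_derivative_def
    by (auto intro!: derivative_eq_intros simp: algebra_simps inner_simps)
  show ?case
    using DERIV_add[OF DERIV_add[OF Suc.IH 3] 2]
    by (simp add: P_def algebra_simps)
qed

text \<open>The recursion for \<open>dheight\<close> is linear, so discrete variation of constants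
  with integrating factor \<open>lam\<close> solves it. Cyclic reindexing then gathers the two terms
  containing each \<open>fst v j\<close> into \<open>gx\<close>.\<close>

lemma dheight_eq_dG: "dheight u v N - snd (snd v) = dG u v"
proof -
  define r where "r j = fst (snd u) j \<bullet> (fst v (Suc j mod N) - fst v j)
     + fst (snd v) j \<bullet> (fst u (Suc j mod N) - fst u j)
     + a j (P u j) \<bullet> fst v j + b j (P u j) \<bullet> fst (snd v) j" for j
  have "lam u j * dheight u v j = lam u 0 * snd (snd v) + (\<Sum>i<j. lam u (Suc i) * r i)" if "j \<le> N" for j
    using that
  proof (induction j)
    case (Suc j)
    have "lam u (Suc j) * dheight u v (Suc j) = lam u j * dheight u v j + lam u (Suc j) * r j"
      using Suc.prems by (simp add: lam_Suc r_def algebra_simps)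
    then show ?case using Suc by simp
  qed simp
  from this[of N] have 1: "dheight u v N = lam u 0 * snd (snd v) + (\<Sum>i<N. lam u (Suc i) * r i)"
    by (simp add: lam_N)
  have 2: "(\<Sum>i<N. lam u (Suc i) * r i) =
     (\<Sum>i<N. lam u (Suc i) * (fst (snd u) i \<bullet> fst v (Suc i mod N)))
     + (\<Sum>i<N. (lam u (Suc i) *\<^sub>R (a i (P u i) - fst (snd u) i)) \<bullet> fst v i + gy u i \<bullet> fst (snd v) i)"
    unfolding sum.distrib[symmetric]
    by (rule sum.cong) (auto simp: r_def gy_def algebra_simps inner_simps inner_commute)
  have 3: "(\<Sum>i<N. lam u (Suc i) * (fst (snd u) i \<bullet> fst v (Suc i mod N))) =
     (\<Sum>i<N. lam u (Suc ((i + N - 1) mod N)) * (fst (snd u) ((i + N - 1) mod N) \<bullet> fst v i))"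
    by (rule sum_cyclic_shift[OF N])
  \<comment> \<open>The predecessor of 0 is \<open>N - 1\<close>, so the weight there is
    \<open>lam u N = 1\<close> and not \<open>lam u 0\<close>; this is the exceptional case in
    \<open>gx\<close>.\<close>
  have 4: "lam u (Suc ((i + N - 1) mod N)) = (if i = 0 then 1 else lam u i)" if "i < N" for i
    using that N by (cases i) (auto simp: lam_N)
  have 5: "(\<Sum>i<N. lam u (Suc ((i + N - 1) mod N)) * (fst (snd u) ((i + N - 1) mod N) \<bullet> fst v i)) =
     (\<Sum>i<N. ((if i = 0 then 1 else lam u i) *\<^sub>R fst (snd u) ((i + N - 1) mod N)) \<bullet> fst v i)"
    by (rule sum.cong) (auto simp del: One_nat_def simp: 4)
  show ?thesis
    unfolding 1 2 3 5 dG_def gx_def gz_def inner_add_left sum.distrib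
    by (simp add: left_diff_distrib)
qed

lemma G_deriv: "((\<lambda>t. G (shift u v t)) has_real_derivative dG (shift u v t) v) (at t)"
  using DERIV_diff[OF height_deriv[of u v N t] height_deriv[of u v 0 t]] dheight_eq_dG[of "shift u v t" v]
  unfolding G_def by simp

lemma dG_descent: "dG u (descent u) = S u / (1 + S u)"
proof -
  have "dG u (descent u) = (\<Sum>j<N. ((norm (gx u j))\<^sup>2 + (norm (gy u j))\<^sup>2) / (1 + S u)) + (gz u)\<^sup>2 / (1 + S u)"
    unfolding dG_def descent_def
    by (auto intro!: arg_cong2[of _ _ _ _ "(+)"] sum.cong
        simp: dot_square_norm power2_eq_square divide_simps)
  also have "\<dots> = S u / (1 + S u)"
    unfolding S_def by (simp add: sum_divide_distrib add_divide_distrib)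
  finally show ?thesis .
qed

lemma descent_in_cube: "descent u \<in> cube 1"
proof -
  have *: "norm p / (1 + S u) \<le> 1" if "(norm p)\<^sup>2 \<le> S u" for p :: "'b::real_normed_vector"
  proof -
    have "norm p \<le> 1 + (norm p)\<^sup>2"
      using zero_le_power2[of "norm p - 1/2"] by (simp add: power2_eq_square algebra_simps)
    then have "norm p \<le> 1 + S u" using that by linarith
    then show ?thesis using S_nonneg[of u] by simp
  qed
  have "\<bar>gz u\<bar> / (1 + S u) \<le> 1"
    using *[of "gz u"] S_bound_gz by simp
  then have "gz u / (1 + S u) \<le> 1" "- 1 \<le> gz u / (1 + S u)"
    using S_nonneg[of u] by (auto simp: abs_le_iff divide_simps)
  moreover have "norm (gx u j) / (1 + S u) \<le> 1" "norm (gy u j) / (1 + S u) \<le> 1" if "j < N" for j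
    using * S_bounds[OF that] by blast+
  ultimately show ?thesis
    using S_nonneg[of u] unfolding descent_def cube_def
    by (auto simp: mem_Times_iff divide_inverse mult.commute)
qed

text \<open>Finitely many Euler steps along \<open>- descent\<close>, cut off below level \<open>e\<close>, replace the gradient flow.\<close>
lemma deform:
  assumes e: "0 < e" and d: "0 < d" and noncrit: "\<And>u. e \<le> G u \<Longrightarrow> d \<le> S u"
  shows "\<exists>T. continuous_on UNIV T \<and> (\<forall>u. G u \<le> e \<longrightarrow> T u = u) \<and> (\<forall>u\<in>cube r. G (T u) \<le> 2 * e)"
proof -
  obtain B where B: "\<And>u. u \<in> cube r \<Longrightarrow> G u \<le> B" and "e \<le> B"
  proof -
    have "compact (G ` cube r)"
      using continuous_G[OF continuous_on_id] compact_cube by (rule compact_continuous_image)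
    then obtain B where "\<And>u. u \<in> cube r \<Longrightarrow> G u \<le> B"
      using compact_imp_bounded[of "G ` cube r"] unfolding bounded_real by (auto dest!: abs_le_D1)
    then show ?thesis using that[of "max e B"] by (meson max.coboundedI2 max.cobounded1)
  qed
  \<comment> \<open>Lower bound at levels above \<open>e\<close> for the slope
    \<open>S u / (1 + S u)\<close>, an increasing function of \<open>S u\<close>.\<close>
  define k where "k = d / (1 + d)"
  have k: "0 < k" using d by (simp add: k_def)
  have kS: "k \<le> dG u (descent u)" if "e \<le> G u" for u
  proof -
    have "1 / (1 + S u) \<le> 1 / (1 + d)"
      using noncrit[OF that] d by (intro divide_left_mono) auto
    moreover have "S u / (1 + S u) = 1 - 1 / (1 + S u)" "d / (1 + d) = 1 - 1 / (1 + d)"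
      using noncrit[OF that] d by (auto simp: field_simps)
    ultimately show ?thesis unfolding dG_descent k_def by linarith
  qed
  \<comment> \<open>Bound on the total distance travelled: each full step lowers \<open>G\<close> by
    at least \<open>s * k / 2\<close>, so about \<open>2 * (B - e) / (k * s)\<close> steps of size
    \<open>s\<close> suffice, and the summand 1 absorbs the rounding.\<close>
  define L where "L = 2 * (B - e) / k + 1"
  define Q where "Q = (cube (r + L) :: 'n broken set) \<times> (cube 1 :: 'n broken set) \<times> {0..1::real}"
  have compQ: "compact Q"
    unfolding Q_def by (intro compact_Times compact_cube) auto
  define h where "h = (\<lambda>(u, v, t). dG (shift u v (- t)) v)"
  have "continuous_on Q h"
    unfolding h_def case_prod_beta
    by (intro continuous_dG continuous_on_shift continuous_intros)
  then have "uniformly_continuous_on Q h"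
    using compQ compact_uniformly_continuous by blast
  \<comment> \<open>Uniform continuity on the compact set \<open>Q\<close> gives one step size for
    which the slope loses less than half of \<open>k\<close> along any whole step.\<close>
  then obtain s' where s': "0 < s'" and
    uc: "\<And>p q. p \<in> Q \<Longrightarrow> q \<in> Q \<Longrightarrow> dist q p < s' \<Longrightarrow> dist (h q) (h p) < k / 2"
    unfolding uniformly_continuous_on_def using k by (meson half_gt_zero)
  define s where "s = min 1 (s' / 2)"
  have s: "0 < s" "s \<le> 1" "s < s'" using s' by (auto simp: s_def)
  \<comment> \<open>Rises continuously from 0 at level \<open>e\<close> to 1 at level
    \<open>2 * e\<close>, so that \<open>T\<close> fixes everything below \<open>e\<close> and takes
    full steps above \<open>2 * e\<close>.\<close>
  define cut where "cut u = min 1 (max 0 ((G u - e) / e))" for u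
  have chi: "0 \<le> cut u" "cut u \<le> 1" for u by (auto simp: cut_def)
  define T where "T u = shift u (descent u) (- (s * cut u))" for u
  have contT: "continuous_on UNIV T"
    unfolding T_def cut_def using e
    by (intro continuous_on_shift continuous_intros continuous_descent continuous_G) auto
  have T_id: "T u = u" if "G u \<le> e" for u
  proof -
    have "(G u - e) / e \<le> 0" using that e by (simp add: divide_simps)
    then have "cut u = 0" unfolding cut_def by (simp add: max_absorb1)
    then show ?thesis by (simp add: T_def)
  qed
  have T_box: "T u \<in> cube (q + s)" if "u \<in> cube q" for u q
    unfolding T_def using that descent_in_cube chi[of u] s
    by (intro shift_in_cube) (auto simp: abs_mult mult_left_le)
  have T_dec: "G (T u) \<le> G u - s * cut u * (k / 2)" if u: "u \<in> cube (r + L)" for u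
  proof (cases "G u \<le> e")
    case True
    then have "cut u = 0"
      using e unfolding cut_def by (auto simp: max_def divide_simps)
    then show ?thesis by (simp add: T_def)
  next
    case False
    define t where "t = s * cut u"
    have "0 < cut u" using False e by (auto simp: cut_def)
    then have t: "0 < t" "t \<le> s" using s chi[of u] by (auto simp: t_def mult_left_le)
    have der: "((\<lambda>x. G (shift u (descent u) (- x))) has_real_derivative - h (u, descent u, x)) (at x)" for x
    proof -
      have "((\<lambda>x::real. - x) has_real_derivative - 1) (at x)"
        by (auto intro!: derivative_eq_intros)
      from DERIV_chain2[where f = "\<lambda>t. G (shift u (descent u) t)", OF G_deriv this]
      show ?thesis by (simp add: h_def)
    qed
    obtain x where x: "0 < x" "x < t" and
      eq: "G (shift u (descent u) (- t)) - G (shift u (descent u) (- 0)) = (t - 0) * - h (u, descent u, x)"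
      using MVT2[of 0 t "\<lambda>x. G (shift u (descent u) (- x))" "\<lambda>x. - h (u, descent u, x)"] der t by auto
    have "dist (h (u, descent u, x)) (h (u, descent u, 0)) < k / 2"
      using u descent_in_cube x t s by (intro uc) (auto simp: Q_def dist_Pair_Pair)
    moreover have "k \<le> h (u, descent u, 0)"
      using kS[of u] False by (simp add: h_def)
    ultimately have "k / 2 \<le> h (u, descent u, x)"
      unfolding dist_real_def by linarith
    then have "t * (k / 2) \<le> t * h (u, descent u, x)"
      using t by simp
    then show ?thesis using eq by (simp add: T_def t_def)
  qed
  define m where "m = nat \<lceil>2 * (B - e) / (k * s)\<rceil>"
  have q0: "0 \<le> 2 * (B - e) / (k * s)" using \<open>e \<le> B\<close> k s by simp
  have m1: "2 * (B - e) / (k * s) \<le> m" unfolding m_def by linarith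
  have m2: "m \<le> 2 * (B - e) / (k * s) + 1" unfolding m_def using q0 by linarith
  have ms1: "B - e \<le> m * (s * (k / 2))"
    using m1 k s by (simp add: divide_simps mult.commute mult.left_commute)
  have ms2: "m * s \<le> L"
  proof -
    have "m * s \<le> (2 * (B - e) / (k * s) + 1) * s"
      using m2 s by (intro mult_right_mono) auto
    also have "\<dots> = 2 * (B - e) / k + s" using s k by (simp add: divide_simps algebra_simps)
    finally show ?thesis using s unfolding L_def by linarith
  qed
  \<comment> \<open>Since \<open>T\<close> never increases \<open>G\<close> inside the large cube, a
    loop that has come below \<open>2 * e\<close> stays there; until then every step is a full
    one.\<close>
  have iter: "(T ^^ i) u \<in> cube (r + i * s) \<and>
      (G ((T ^^ i) u) \<le> 2 * e \<or> G ((T ^^ i) u) \<le> G u - i * (s * (k / 2)))"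
    if "u \<in> cube r" "i \<le> m" for i u
    using that(2)
  proof (induction i)
    case 0
    then show ?case using that by simp
  next
    case (Suc i)
    let ?w = "(T ^^ i) u"
    have w: "?w \<in> cube (r + i * s)" using Suc by simp
    have "i * s \<le> m * s" using Suc.prems s by (intro mult_right_mono) auto
    then have "r + i * s \<le> r + L" using ms2 by linarith
    then have wL: "?w \<in> cube (r + L)"
      using w unfolding cube_def by (auto simp: mem_Times_iff intro: order_trans)
    have 1: "T ?w \<in> cube (r + Suc i * s)"
      using T_box[OF w] by (simp add: algebra_simps)
    have 2: "G (T ?w) \<le> G ?w - s * cut ?w * (k / 2)"
      using T_dec[OF wL] .
    have 3: "0 \<le> s * cut ?w * (k / 2)" using s k chi[of ?w] by simp
    have "G (T ?w) \<le> 2 * e \<or> G (T ?w) \<le> G u - Suc i * (s * (k / 2))"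
    proof (cases "G ?w \<le> 2 * e")
      case True
      then show ?thesis using 2 3 by linarith
    next
      case False
      then have "cut ?w = 1" using e by (auto simp: cut_def min_def max_def divide_simps)
      then have "G (T ?w) \<le> G ?w - s * (k / 2)" using 2 by simp
      moreover have "G ?w \<le> G u - i * (s * (k / 2))" using Suc False by auto
      moreover have "Suc i * (s * (k / 2)) = i * (s * (k / 2)) + s * (k / 2)"
        by (simp add: algebra_simps)
      ultimately show ?thesis by linarith
    qed
    then show ?case using 1 by simp
  qed
  have cont_iter: "continuous_on UNIV (T ^^ i)" for i
    by (induction i) (auto intro!: continuous_on_compose2[OF contT] simp: o_def id_def)
  have "G ((T ^^ m) u) \<le> 2 * e" if "u \<in> cube r" for u
    using iter[OF that, of m] ms1 B[OF that] e by auto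
  moreover have "(T ^^ i) u = u" if "G u \<le> e" for i u
    using T_id[OF that] by (induction i) auto
  ultimately show ?thesis
    using cont_iter by blast
qed

section \<open>Uniform bounds and the Palais-Smale condition\<close>

lemma family_bound:
  fixes g :: "nat \<Rightarrow> 'n pt \<Rightarrow> 'b::real_normed_vector"
  assumes "\<And>j. continuous_on UNIV (g j)" "\<And>j p. p \<notin> K \<Longrightarrow> g j p = 0"
  shows "\<exists>B\<ge>0. \<forall>j<N. \<forall>p. norm (g j p) \<le> B"
proof -
  have "\<exists>B. \<forall>p\<in>K. norm (g j p) \<le> B" for j
    using compact_imp_bounded[OF compact_continuous_image[OF continuous_on_subset[OF assms(1) subset_UNIV] compact_K], of j]
    unfolding bounded_iff by auto
  then obtain B where B: "\<And>j p. p \<in> K \<Longrightarrow> norm (g j p) \<le> B j" by metis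
  have "norm (g j p) \<le> (\<Sum>i<N. \<bar>B i\<bar>)" if "j < N" for j p
  proof (cases "p \<in> K")
    case True
    have "\<bar>B j\<bar> \<le> (\<Sum>i<N. \<bar>B i\<bar>)" using that by (intro member_le_sum) auto
    then show ?thesis using B[OF True, of j] by linarith
  qed (auto simp: assms(2) sum_nonneg)
  then show ?thesis by (intro exI[of _ "\<Sum>i<N. \<bar>B i\<bar>"]) (auto simp: sum_nonneg)
qed

lemma bounds:
  obtains C m R where "0 \<le> C" "0 < m" "m \<le> 1" "0 \<le> R"
    "\<And>j p. j < N \<Longrightarrow> f j p \<le> C" "\<And>j p. j < N \<Longrightarrow> norm (a j p) \<le> C"
    "\<And>j p. j < N \<Longrightarrow> norm (b j p) \<le> C"
    "\<And>j p. j < N \<Longrightarrow> m \<le> 1 + c j p" "\<And>j p. j < N \<Longrightarrow> 1 + c j p \<le> 1 + C"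
    "\<And>x y z. (x, y, z) \<in> K \<Longrightarrow> norm x \<le> R \<and> norm y \<le> R \<and> \<bar>z\<bar> \<le> R"
proof -
  have c_nz: "1 + c j p \<noteq> 0" for j p using c_pos[of j p] by linarith
  obtain B1 where B1: "0 \<le> B1" "\<And>j p. j < N \<Longrightarrow> norm (f j p) \<le> B1"
    using family_bound[of f] cont_f supp by blast
  obtain B2 where B2: "0 \<le> B2" "\<And>j p. j < N \<Longrightarrow> norm (a j p) \<le> B2"
    using family_bound[of a] cont_a supp_deriv by blast
  obtain B3 where B3: "0 \<le> B3" "\<And>j p. j < N \<Longrightarrow> norm (b j p) \<le> B3"
    using family_bound[of b] cont_b supp_deriv by blast
  obtain B4 where B4: "0 \<le> B4" "\<And>j p. j < N \<Longrightarrow> norm (c j p) \<le> B4"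
    using family_bound[of c] cont_c supp_deriv by blast
  \<comment> \<open>\<open>1 / (1 + c) - 1\<close> also vanishes off \<open>K\<close>, so its
    boundedness yields a positive lower bound for the conformal factors.\<close>
  have "\<exists>B\<ge>0. \<forall>j<N. \<forall>p. norm (1 / (1 + c j p) - 1) \<le> B"
    by (rule family_bound[of "\<lambda>j p. 1 / (1 + c j p) - 1"])
       (auto intro!: continuous_intros cont_c simp: c_nz supp_deriv)
  then obtain B5 where B5: "0 \<le> B5" "\<And>j p. j < N \<Longrightarrow> norm (1 / (1 + c j p) - 1) \<le> B5" by blast
  obtain R where R: "\<And>p. p \<in> K \<Longrightarrow> norm p \<le> R"
    using compact_imp_bounded[OF compact_K] unfolding bounded_iff by blast
  have KR: "norm x \<le> max 0 R \<and> norm y \<le> max 0 R \<and> \<bar>z\<bar> \<le> max 0 R" if "(x, y, z) \<in> K" for x y z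
    using R[OF that] norm_fst_le[of x "(y, z)"] norm_snd_le[of "(y, z)" x] norm_fst_le[of y z]
      norm_snd_le[of z y] by (auto simp: real_norm_def)
  have m: "1 / (1 + B5) \<le> 1 + c j p" if "j < N" for j p
  proof -
    have "1 / (1 + c j p) \<le> 1 + B5"
      using B5(2)[OF that, of p] by (simp add: abs_le_iff)
    then show ?thesis using c_pos[of j p] B5(1) by (simp add: field_simps)
  qed
  show ?thesis
    by (rule that[of "max (max B1 B2) (max B3 B4)" "1 / (1 + B5)" "max 0 R"])
       (use B1 B2 B3 B4 B5(1) m KR in
        \<open>auto simp: abs_le_iff le_max_iff_disj intro: order_trans[OF abs_ge_self]\<close>)
qed

lemma lam_bounds:
  assumes "0 < m" "m \<le> 1" "0 \<le> C"
    "\<And>j p. j < N \<Longrightarrow> m \<le> 1 + c j p" "\<And>j p. j < N \<Longrightarrow> 1 + c j p \<le> 1 + C"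
  shows "m ^ N \<le> lam u j" "lam u j \<le> (1 + C) ^ N"
proof -
  have "m ^ N \<le> m ^ (N - j)"
    using assms by (intro power_decreasing) auto
  also have "m ^ (N - j) = (\<Prod>i\<in>{j..<N}. m)" by simp
  also have "\<dots> \<le> lam u j"
    unfolding lam_def using assms by (intro prod_mono) auto
  finally show "m ^ N \<le> lam u j" .
  have "lam u j \<le> (\<Prod>i\<in>{j..<N}. 1 + C)"
    unfolding lam_def using assms c_pos by (intro prod_mono) (auto simp: less_imp_le)
  also have "\<dots> = (1 + C) ^ (N - j)" by simp
  also have "\<dots> \<le> (1 + C) ^ N"
    using assms by (intro power_increasing) auto
  finally show "lam u j \<le> (1 + C) ^ N" .
qed

lemma sum_diff_0: "(\<Sum>j<N. x (Suc j mod N) - x j) = (0 :: 'b::real_normed_vector)"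
  using sum_cyclic_shift[OF N, of "\<lambda>_ k. x k"] by (simp add: sum_subtractf)

text \<open>If no corner met \<open>K\<close>, only the quadratic form would remain, and a small
  gradient would keep it below \<open>e\<close>. Hence some corner lies in \<open>K\<close>. From
  there smallness of \<open>gy\<close> bounds all nodes, smallness of \<open>gx\<close> bounds all
  momenta, and both together bound the heights.\<close>

lemma palais_smale:
  assumes e: "0 < e"
  shows "\<exists>d>0. \<exists>R. \<forall>u. e \<le> G u \<and> S u < d \<longrightarrow>
     (\<forall>j<N. norm (fst u j) \<le> R \<and> norm (fst (snd u) j) \<le> R) \<and> \<bar>snd (snd u)\<bar> \<le> R"
proof -
  obtain C m R0 where C: "0 \<le> C" and m: "0 < m" "m \<le> 1" and R0: "0 \<le> R0"
    and fC: "\<And>j p. j < N \<Longrightarrow> f j p \<le> C" and aC: "\<And>j p. j < N \<Longrightarrow> norm (a j p) \<le> C"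
    and bC: "\<And>j p. j < N \<Longrightarrow> norm (b j p) \<le> C"
    and cm: "\<And>j p. j < N \<Longrightarrow> m \<le> 1 + c j p" "\<And>j p. j < N \<Longrightarrow> 1 + c j p \<le> 1 + C"
    and KR: "\<And>x y z. (x, y, z) \<in> K \<Longrightarrow> norm x \<le> R0 \<and> norm y \<le> R0 \<and> \<bar>z\<bar> \<le> R0"
    using bounds by blast
  note lb = lam_bounds[OF m C cm]
  define v where "v = m ^ N"
  define M where "M = (1 + C) ^ N"
  have v: "0 < v" using m by (simp add: v_def)
  have M: "0 < M" using C by (simp add: M_def)
  \<comment> \<open>Forces \<open>N^2 * d\<close> to be at most \<open>e / 2\<close>, where
    \<open>N^2 * d\<close> is the bound on the quadratic form obtained away from
    \<open>K\<close>.\<close>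
  define d where "d = min 1 (e / (2 * (real N)\<^sup>2))"
  have d: "0 < d" "d \<le> 1" using e N by (auto simp: d_def)
  define D where "D = 1 / v + C"
  have D: "0 \<le> D" using v C by (simp add: D_def)
  define \<alpha> where "\<alpha> = (1 + M * C) / v"
  define \<beta> where "\<beta> = M / v"
  have ab: "0 \<le> \<alpha>" "0 \<le> \<beta>" using v M C by (auto simp: \<alpha>_def \<beta>_def)
  \<comment> \<open>\<open>B k\<close> will bound the momentum stored \<open>k\<close> places
    cyclically before a corner lying in \<open>K\<close>.\<close>
  define B where "B = rec_nat R0 (\<lambda>_ r. \<alpha> + \<beta> * r)"
  have B_simps: "B 0 = R0" "B (Suc k) = \<alpha> + \<beta> * B k" for k by (auto simp: B_def)
  have B0: "0 \<le> B k" for k by (induction k) (auto simp: B_simps R0 ab)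
  define R2 where "R2 = (\<Sum>k\<le>N. B k)"
  have R2: "0 \<le> R2" unfolding R2_def using B0 by (intro sum_nonneg) auto
  define R1 where "R1 = R0 + N * D"
  define R3 where "R3 = R0 + N * (R2 * D + C)"
  have main: "(\<forall>j<N. norm (fst u j) \<le> R1 \<and> norm (fst (snd u) j) \<le> R2) \<and> \<bar>snd (snd u)\<bar> \<le> R3"
    if G: "e \<le> G u" and S: "S u < d" for u
  proof -
    define x where "x = fst u"
    define y where "y = fst (snd u)"
    have gx2: "norm (gx u j) \<le> sqrt d" and gy2: "norm (gy u j) \<le> sqrt d" if "j < N" for j
      using S_bounds[OF that, of u] S by (auto intro!: real_le_rsqrt)
    have sd: "sqrt d \<le> 1" using d by simp
    have gx1: "norm (gx u j) \<le> 1" and gy1: "norm (gy u j) \<le> 1" if "j < N" for j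
      using gx2[OF that] gy2[OF that] sd by linarith+
    have "\<exists>j<N. P u j \<in> K"
    proof (rule ccontr)
      assume "\<not> (\<exists>j<N. P u j \<in> K)"
      then have out: "P u j \<notin> K" if "j < N" for j using that by blast
      have lam1: "lam u j = 1" for j
        unfolding lam_def using out supp_deriv by (intro prod.neutral) auto
      have dy: "norm (y (Suc j) - y j) \<le> sqrt d" if "Suc j < N" for j
        using gx2[OF that] supp_deriv(1)[OF out[OF that]] that
        unfolding gx_def lam1 y_def by (simp add: norm_minus_commute)
      have y0: "norm (y j - y 0) \<le> N * sqrt d" if "j < N" for j
      proof -
        have "norm (y j - y 0) \<le> norm (y 0 - y 0) + real (N - 1) * sqrt d"
          by (rule norm_chain[where g = "\<lambda>j. y j - y 0"]) (use dy that d in auto)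
        also have "\<dots> \<le> N * sqrt d" using d by (auto intro!: mult_right_mono)
        finally show ?thesis .
      qed
      have dx: "norm (x (Suc j mod N) - x j) \<le> sqrt d" if "j < N" for j
        using gy2[OF that] supp_deriv(2)[OF out[OF that]]
        unfolding gy_def lam1 x_def by simp
      have "G u = (\<Sum>j<N. y j \<bullet> (x (Suc j mod N) - x j))"
        unfolding G_eq x_def y_def using out supp by simp
      \<comment> \<open>Subtracting the constant \<open>y 0\<close> is free because the
        displacements of a closed loop sum to 0; afterwards both factors of each term are of order
        \<open>sqrt d\<close>.\<close>
      also have "\<dots> = (\<Sum>j<N. (y j - y 0) \<bullet> (x (Suc j mod N) - x j)) + y 0 \<bullet> (\<Sum>j<N. x (Suc j mod N) - x j)"
        unfolding inner_sum_right sum.distrib[symmetric] inner_add_left[symmetric] by simp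
      also have "\<dots> = (\<Sum>j<N. (y j - y 0) \<bullet> (x (Suc j mod N) - x j))"
        unfolding sum_diff_0 by simp
      also have "\<dots> \<le> (\<Sum>j<N. N * d)"
      proof (rule sum_mono)
        fix j assume "j \<in> {..<N}"
        then have j: "j < N" by simp
        have "(y j - y 0) \<bullet> (x (Suc j mod N) - x j) \<le> norm (y j - y 0) * norm (x (Suc j mod N) - x j)"
          by (rule norm_cauchy_schwarz)
        also have "\<dots> \<le> (N * sqrt d) * sqrt d"
          using y0[OF j] dx[OF j] d by (intro mult_mono) auto
        also have "\<dots> = N * d" using d by simp
        finally show "(y j - y 0) \<bullet> (x (Suc j mod N) - x j) \<le> N * d" .
      qed
      also have "\<dots> = (real N)\<^sup>2 * d" by (simp add: power2_eq_square)
      also have "\<dots> \<le> (real N)\<^sup>2 * (e / (2 * (real N)\<^sup>2))"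
        by (intro mult_left_mono) (auto simp: d_def)
      also have "\<dots> < e" using e N by simp
      finally show False using G by simp
    qed
    then obtain j where j: "j < N" "P u j \<in> K" by blast
    then have j0: "norm (x j) \<le> R0" "norm (y j) \<le> R0" "\<bar>height u j\<bar> \<le> R0"
      using KR unfolding P_def x_def y_def by auto
    have dx: "norm (x (Suc i mod N) - x i) \<le> D" if "i < N" for i
    proof -
      define \<Delta> where "\<Delta> = x (Suc i mod N) - x i"
      have "lam u (Suc i) * norm (\<Delta> + b i (P u i)) \<le> 1"
        using gy1[OF that] lam_pos[of u "Suc i"] unfolding gy_def x_def \<Delta>_def by (simp add: abs_mult)
      moreover have "v * norm (\<Delta> + b i (P u i)) \<le> lam u (Suc i) * norm (\<Delta> + b i (P u i))"
        using lb(1) unfolding v_def by (intro mult_right_mono) auto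
      ultimately have "norm (\<Delta> + b i (P u i)) \<le> 1 / v"
        using v by (simp add: field_simps)
      then show ?thesis
        using bC[OF that, of "P u i"] norm_triangle_ineq4[of "\<Delta> + b i (P u i)" "b i (P u i)"]
        unfolding D_def \<Delta>_def by simp
    qed
    have x: "norm (x i) \<le> R1" if "i < N" for i
    proof -
      have "norm (x (i mod N)) \<le> norm (x (j mod N)) + N * D"
        by (rule norm_chain[where g = "\<lambda>i. x (i mod N)"]) (use dx that j D in auto)
      then show ?thesis using that j j0 unfolding R1_def by simp
    qed
    \<comment> \<open>The formula for \<open>gx\<close> is solved for the preceding momentum, so
      bounds propagate backwards along the loop. The weight 1 at \<open>i = 0\<close> is covered
      because \<open>v\<close> is at most 1.\<close>
    have ypred: "norm (y ((i + N - 1) mod N)) \<le> \<alpha> + \<beta> * norm (y i)" if "i < N" for i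
    proof -
      define l where "l = (if i = 0 then 1 else lam u i)"
      have "m ^ N \<le> 1" using m by (intro power_le_one) auto
      then have l: "v \<le> l" using lb(1) unfolding l_def v_def by auto
      have "l *\<^sub>R y ((i + N - 1) mod N) = gx u i - lam u (Suc i) *\<^sub>R (a i (P u i) - y i)"
        unfolding gx_def l_def y_def by simp
      then have "norm (l *\<^sub>R y ((i + N - 1) mod N)) \<le> norm (gx u i) + norm (lam u (Suc i) *\<^sub>R (a i (P u i) - y i))"
        using norm_triangle_ineq4 by metis
      also have "norm (lam u (Suc i) *\<^sub>R (a i (P u i) - y i)) = lam u (Suc i) * norm (a i (P u i) - y i)"
        using lam_pos[of u "Suc i"] by simp
      also have "\<dots> \<le> M * (C + norm (y i))"
        using lb(2)[of u "Suc i"] lam_pos[of u "Suc i"] M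
          norm_triangle_ineq4[of "a i (P u i)" "y i"] aC[OF that, of "P u i"]
        unfolding M_def by (intro mult_mono) auto
      finally have "l * norm (y ((i + N - 1) mod N)) \<le> 1 + M * (C + norm (y i))"
        using gx1[OF that] l v by simp
      moreover have "v * norm (y ((i + N - 1) mod N)) \<le> l * norm (y ((i + N - 1) mod N))"
        using l by (intro mult_right_mono) auto
      ultimately have "norm (y ((i + N - 1) mod N)) \<le> (1 + M * (C + norm (y i))) / v"
        using v by (simp add: field_simps)
      also have "\<dots> = \<alpha> + \<beta> * norm (y i)"
        unfolding \<alpha>_def \<beta>_def by (simp add: add_divide_distrib distrib_left)
      finally show ?thesis .
    qed
    have yk: "norm (y ((j + N - k) mod N)) \<le> B k" if "k \<le> N" for k
      using that
    proof (induction k)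
      case 0
      then show ?case using j j0 by (simp add: B_simps)
    next
      case (Suc k)
      define i where "i = (j + N - k) mod N"
      have "(i + N - 1) mod N = (i + (N - 1)) mod N" using N by simp
      also have "\<dots> = (j + N - k + (N - 1)) mod N" unfolding i_def by (rule mod_add_left_eq)
      also have "j + N - k + (N - 1) = (j + N - Suc k) + N" using N Suc.prems by simp
      finally have eq: "(i + N - 1) mod N = (j + N - Suc k) mod N" by simp
      have "norm (y ((j + N - Suc k) mod N)) \<le> \<alpha> + \<beta> * norm (y i)"
        using ypred[of i] N unfolding eq by (simp add: i_def)
      also have "\<dots> \<le> \<alpha> + \<beta> * B k"
        using Suc ab unfolding i_def by (intro add_left_mono mult_left_mono) auto
      finally show ?case by (simp add: B_simps)
    qed
    have y: "norm (y i) \<le> R2" if "i < N" for i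
    proof -
      \<comment> \<open>The number of backward steps from \<open>j\<close> to \<open>i\<close>,
        passing through 0 when \<open>i\<close> comes after \<open>j\<close>.\<close>
      define k where "k = (if i \<le> j then j - i else j + N - i)"
      have k: "k \<le> N" "(j + N - k) mod N = i" using that j by (auto simp: k_def)
      have "B k \<le> R2" unfolding R2_def using k B0 by (intro member_le_sum) auto
      then show ?thesis using yk[OF k(1)] k by simp
    qed
    have dzz: "norm (height u (Suc i) - height u i) \<le> R2 * D + C" if i: "i < N" for i
    proof -
      have "\<bar>y i \<bullet> (x (Suc i mod N) - x i)\<bar> \<le> norm (y i) * norm (x (Suc i mod N) - x i)"
        by (rule Cauchy_Schwarz_ineq2)
      also have "\<dots> \<le> R2 * D" using y[OF i] dx[OF i] R2 by (intro mult_mono) auto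
      finally show "norm (height u (Suc i) - height u i) \<le> R2 * D + C"
        using fC[OF i, of "P u i"] nonneg[of i "P u i"] by (simp add: x_def y_def P_def)
    qed
    have "norm (height u 0) \<le> norm (height u j) + N * (R2 * D + C)"
      by (rule norm_chain[where g = "height u", OF dzz]) (use j R2 D C in auto)
    then have "\<bar>snd (snd u)\<bar> \<le> R3" using j0 by (simp add: R3_def)
    then show ?thesis using x y unfolding x_def y_def by blast
  qed
  show ?thesis
    using main d by (intro exI[of _ d] conjI exI[of _ "max R1 (max R2 R3)"]) (auto simp: le_max_iff_disj)
qed

text \<open>Entries from index \<open>N\<close> on influence neither \<open>G\<close> nor
  \<open>S\<close>; setting them to 0 moves a loop with bounded corners into a compact cube.\<close>

definition trunc :: "'n broken \<Rightarrow> 'n broken" where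
  "trunc u = (\<lambda>j. if j < N then fst u j else 0, \<lambda>j. if j < N then fst (snd u) j else 0, snd (snd u))"

lemma height_trunc: "j \<le> N \<Longrightarrow> height (trunc u) j = height u j"
  using N by (induction j) (auto simp: trunc_def)

lemma G_trunc: "G (trunc u) = G u"
  unfolding G_def using height_trunc[of N u] height_trunc[of 0 u] by simp

lemma P_trunc: "j < N \<Longrightarrow> P (trunc u) j = P u j"
  using height_trunc[of j u] by (simp add: P_def) (simp add: trunc_def)

lemma S_trunc: "S (trunc u) = S u"
proof -
  have l: "lam (trunc u) j = lam u j" for j
    unfolding lam_def by (intro prod.cong) (auto simp: P_trunc)
  have "gx (trunc u) j = gx u j" "gy (trunc u) j = gy u j" if "j < N" for j
    using that N unfolding gx_def gy_def l P_trunc[OF that] by (auto simp: trunc_def)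
  moreover have "gz (trunc u) = gz u" by (simp add: gz_def l)
  ultimately show ?thesis unfolding S_def by simp
qed

text \<open>By the Palais-Smale bound, nearly critical loops at level \<open>e\<close> or higher lie
  after truncation in a compact set, on which \<open>S\<close> attains a positive minimum.\<close>

lemma noncritical_uniform:
  assumes e: "0 < e" and no: "\<And>u. e \<le> G u \<Longrightarrow> S u \<noteq> 0"
  shows "\<exists>d>0. \<forall>u. e \<le> G u \<longrightarrow> d \<le> S u"
proof -
  obtain d R where d: "0 < d" and R: "\<And>u. e \<le> G u \<Longrightarrow> S u < d \<Longrightarrow>
     (\<forall>j<N. norm (fst u j) \<le> R \<and> norm (fst (snd u) j) \<le> R) \<and> \<bar>snd (snd u)\<bar> \<le> R"
    using palais_smale[OF e] by blast
  define A where "A = cube (max 0 R) \<inter> {u. e \<le> G u}"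
  have "closed {u. e \<le> G u}"
    by (intro closed_Collect_le continuous_intros continuous_G)
  then have "compact A" unfolding A_def using compact_cube by (rule compact_Int_closed[rotated])
  have in_A: "trunc u \<in> A" if "e \<le> G u" "S u < d" for u
    using R[OF that] that(1) unfolding A_def
    by (auto simp: G_trunc) (auto simp: trunc_def cube_def le_max_iff_disj)
  show ?thesis
  proof (cases "A = {}")
    case True
    then show ?thesis using in_A d by (metis empty_iff linorder_not_less)
  next
    case False
    obtain u0 where u0: "u0 \<in> A" "\<And>u. u \<in> A \<Longrightarrow> S u0 \<le> S u"
      using continuous_attains_inf[OF \<open>compact A\<close> False continuous_S[OF continuous_on_id]] by blast
    have "0 < S u0" using u0(1) no[of u0] S_nonneg[of u0] unfolding A_def by auto
    moreover have "min d (S u0) \<le> S u" if "e \<le> G u" for u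
      using in_A[OF that] u0(2)[of "trunc u"] by (cases "S u < d") (auto simp: S_trunc)
    ultimately show ?thesis using d by (intro exI[of _ "min d (S u0)"]) auto
  qed
qed

section \<open>Linking\<close>

text \<open>The linking pair: the affine disc \<open>Y\<^bsub>j+1\<^esub> = const - (x\<^bsub>j+1\<^esub> - x\<^sub>j)\<close>, on which the quadratic part is
  negative, and the zero set of \<open>link\<close>, on which \<open>Y\<^bsub>j+1\<^esub> = const + (x\<^bsub>j+1\<^esub> - x\<^sub>j)\<close> and it is positive.
  The disc is parametrised so that \<open>link\<close> becomes the identity on it.\<close>
definition pvec :: "((nat \<times> 'n) option \<Rightarrow> real) \<Rightarrow> nat \<Rightarrow> real ^ 'n" where
  "pvec w j = (\<chi> i. w (Some (j, i)))"

definition pmean :: "((nat \<times> 'n) option \<Rightarrow> real) \<Rightarrow> real ^ 'n" where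
  "pmean w = (1 / real N) *\<^sub>R (\<Sum>j<N. pvec w j)"

text \<open>The displacement of step \<open>j\<close> on the disc. With momentum
  \<open>fst (snd q) + pmean w - pdiff w j\<close> the value of \<open>link\<close> is
  \<open>pmean w - 2 * pdiff w j\<close>, and this formula makes it equal to
  \<open>pvec w j\<close>. Using the mean makes the displacements sum to 0, so the loop
  closes.\<close>

definition pdiff :: "((nat \<times> 'n) option \<Rightarrow> real) \<Rightarrow> nat \<Rightarrow> real ^ 'n" where
  "pdiff w j = (1/2) *\<^sub>R (pmean w - pvec w j)"

text \<open>The parameters \<open>Some (N, i)\<close> move the starting node and \<open>None\<close>
  the starting height; those with smaller corner index determine the momenta and
  displacements.\<close>

definition disc :: "'n pt \<Rightarrow> ((nat \<times> 'n) option \<Rightarrow> real) \<Rightarrow> 'n broken" where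
  "disc q w = (\<lambda>j. if j < N then fst q + pvec w N + (\<Sum>i<j. pdiff w i) else 0,
              \<lambda>j. if j < N then fst (snd q) + pmean w - pdiff w j else 0, snd (snd q) + w None)"

definition link :: "'n pt \<Rightarrow> 'n broken \<Rightarrow> (nat \<times> 'n) option \<Rightarrow> real" where
  "link q u k = (case k of None \<Rightarrow> snd (snd u) - snd (snd q)
     | Some (j, i) \<Rightarrow> if j < N then (fst (snd u) j - (fst u (Suc j mod N) - fst u j) - fst (snd q)) $ i
                      else (fst u 0 - fst q) $ i)"

definition link_index :: "(nat \<times> 'n) option set" where
  "link_index = insert None (Some ` ({..N} \<times> UNIV))"

lemma finite_link_index: "finite link_index"
  unfolding link_index_def by auto

lemma sum_pdiff: "(\<Sum>j<N. pdiff w j) = 0"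
  unfolding pdiff_def scaleR_sum_right[symmetric] sum_subtractf pmean_def using N
  by (simp add: sum_constant_scaleR del: sum_constant)

lemma disc_diff: "j < N \<Longrightarrow> fst (disc q w) (Suc j mod N) - fst (disc q w) j = pdiff w j"
proof (cases "Suc j = N")
  case True
  \<comment> \<open>The last step returns to node 0; its displacement is forced by the vanishing of
    the total displacement.\<close>
  then have "(\<Sum>i<j. pdiff w i) + pdiff w j = 0"
    using sum_pdiff[of w] by (metis sum.lessThan_Suc)
  then have 1: "- (\<Sum>i<j. pdiff w i) = pdiff w j" by (rule minus_unique)
  have 2: "Suc j mod N = 0" "j < N" using True by auto
  show ?thesis unfolding 2(1) 1[symmetric] using 2(2) N by (simp add: disc_def)
qed (auto simp: disc_def)

lemma link_disc:
  assumes "k \<in> link_index"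
  shows "link q (disc q w) k = w k"
proof -
  have "link q (disc q w) (Some (j, i)) = w (Some (j, i))" if "j < N" for j i
  proof -
    have y: "fst (snd (disc q w)) j = fst (snd q) + pmean w - pdiff w j"
      using that by (simp add: disc_def)
    have "pdiff w j + pdiff w j = pmean w - pvec w j"
      unfolding pdiff_def by (simp flip: scaleR_add_left)
    then have p: "fst (snd q) + pmean w - pdiff w j - pdiff w j - fst (snd q) = pvec w j"
      by (simp add: algebra_simps)
    have "link q (disc q w) (Some (j, i)) = pvec w j $ i"
      unfolding link_def option.case prod.case disc_diff[OF that] y p using that by simp
    then show ?thesis by (simp add: pvec_def)
  qed
  moreover have "link q (disc q w) (Some (N, i)) = w (Some (N, i))" for i
    using N by (simp add: link_def disc_def pvec_def)
  moreover have "link q (disc q w) None = w None" by (simp add: link_def disc_def)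
  ultimately show ?thesis using assms unfolding link_index_def by (force simp: le_less)
qed

lemma continuous_link: "continuous_on A U \<Longrightarrow> continuous_on A (\<lambda>t. link q (U t) k)"
proof (cases k)
  case (Some p)
  assume U: "continuous_on A U"
  obtain j i where p: "p = (j, i)" by (cases p)
  show ?thesis
    unfolding link_def Some p using continuous_on_broken[OF U]
    by (cases "j < N") (auto intro!: continuous_intros)
qed (auto simp: link_def intro!: continuous_intros continuous_on_broken)

lemma continuous_pvec: "continuous_on UNIV (\<lambda>w. pvec w j)"
  unfolding pvec_def by (intro continuous_on_vec_lambda continuous_on_product_coordinates)

lemma continuous_pdiff: "continuous_on UNIV (\<lambda>w. pmean w)" "continuous_on UNIV (\<lambda>w. pdiff w j)"
  unfolding pmean_def pdiff_def by (intro continuous_intros continuous_pvec)+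

lemma continuous_disc: "continuous_on UNIV (disc q)"
proof -
  have 1: "continuous_on UNIV (\<lambda>w. if j < N then fst q + pvec w N + (\<Sum>i<j. pdiff w i) else 0)" for j
    by (cases "j < N") (auto intro!: continuous_intros continuous_pvec continuous_pdiff)
  have 2: "continuous_on UNIV (\<lambda>w. if j < N then fst (snd q) + pmean w - pdiff w j else 0)" for j
    by (cases "j < N") (auto intro!: continuous_intros continuous_pvec continuous_pdiff)
  show ?thesis
    unfolding disc_def
    by (intro continuous_on_Pair continuous_on_coordinatewise_then_product 1 2
        continuous_on_add continuous_on_const continuous_on_product_coordinates)
qed

lemma norm_pvec:
  fixes R :: real
  assumes "\<And>k. \<bar>w k\<bar> \<le> R"
  shows "norm (pvec w j) \<le> CARD('n) * R"
proof -
  have "norm (pvec w j) \<le> (\<Sum>i\<in>UNIV. \<bar>pvec w j $ i\<bar>)" by (rule norm_le_l1_cart)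
  also have "\<dots> \<le> (\<Sum>i\<in>(UNIV :: 'n set). R)" using assms by (intro sum_mono) (auto simp: pvec_def)
  finally show ?thesis by simp
qed

lemma disc_in_cube: fixes R :: real shows "\<exists>r. \<forall>w. (\<forall>k. \<bar>w k\<bar> \<le> R) \<longrightarrow> disc q w \<in> cube r"
proof -
  define A where "A = CARD('n) * R"
  define r where "r = norm (fst q) + A + N * A + norm (fst (snd q)) + 2 * A + \<bar>snd (snd q)\<bar> + R"
  have "disc q w \<in> cube r" if w: "\<And>k. \<bar>w k\<bar> \<le> R" for w
  proof -
    have R: "0 \<le> R" using w[of None] by linarith
    then have A: "0 \<le> A" "0 \<le> N * A" by (auto simp: A_def)
    have pvec: "norm (pvec w j) \<le> A" for j using norm_pvec[OF w] by (simp add: A_def)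
    have mean: "norm (pmean w) \<le> A"
    proof -
      have "norm (\<Sum>j<N. pvec w j) \<le> (\<Sum>j<N. A)" by (rule sum_norm_le) (rule pvec)
      then show ?thesis unfolding pmean_def using N by (simp add: field_simps)
    qed
    have diff: "norm (pdiff w j) \<le> A" for j
      unfolding pdiff_def using norm_triangle_ineq4[of "pmean w" "pvec w j"] mean pvec[of j] by simp
    have sd: "norm (\<Sum>i<j. pdiff w i) \<le> N * A" if "j < N" for j
    proof -
      have "norm (\<Sum>i<j. pdiff w i) \<le> (\<Sum>i<j. A)" by (rule sum_norm_le) (rule diff)
      also have "\<dots> \<le> N * A" using that A by (simp add: mult_right_mono)
      finally show ?thesis .
    qed
    have 1: "norm (fst q + pvec w N + (\<Sum>i<j. pdiff w i)) \<le> r" if "j < N" for j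
      using norm_triangle_ineq[of "fst q + pvec w N" "\<Sum>i<j. pdiff w i"] norm_triangle_ineq[of "fst q" "pvec w N"]
        pvec[of N] sd[OF that] A R unfolding r_def by (smt (verit) norm_ge_zero)
    have 2: "norm (fst (snd q) + pmean w - pdiff w j) \<le> r" for j
      using norm_triangle_ineq4[of "fst (snd q) + pmean w" "pdiff w j"]
        norm_triangle_ineq[of "fst (snd q)" "pmean w"] mean diff[of j] A R
      unfolding r_def by (smt (verit) norm_ge_zero)
    have "\<bar>w None\<bar> \<le> R" by (rule w)
    then have 3: "\<bar>snd (snd q) + w None\<bar> \<le> r"
      using A unfolding r_def by (smt (verit) norm_ge_zero)
    have "0 \<le> r" using A R unfolding r_def by (smt (verit) norm_ge_zero)
    then show ?thesis using 1 2 3 unfolding disc_def cube_def by (auto simp: abs_le_iff)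
  qed
  then show ?thesis by blast
qed

section \<open>The functional on the linking pair\<close>

lemma G_disc: "G (disc q w) = (\<Sum>j<N. f j (P (disc q w) j)) - (\<Sum>j<N. (norm (pdiff w j))\<^sup>2)"
proof -
  have "G (disc q w) = (\<Sum>j<N. (fst (snd q) + pmean w - pdiff w j) \<bullet> pdiff w j) + (\<Sum>j<N. f j (P (disc q w) j))"
    unfolding G_eq using disc_diff[of _ q w] by (auto simp: disc_def intro!: sum.cong)
  also have "(\<Sum>j<N. (fst (snd q) + pmean w - pdiff w j) \<bullet> pdiff w j) =
      (fst (snd q) + pmean w) \<bullet> (\<Sum>j<N. pdiff w j) - (\<Sum>j<N. (norm (pdiff w j))\<^sup>2)"
    by (simp add: inner_sum_right inner_diff_left sum_subtractf dot_square_norm)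
  finally show ?thesis by (simp add: sum_pdiff)
qed

text \<open>Where \<open>G\<close> is positive on the disc, some corner lies in \<open>K\<close> and
  the squares of the displacements sum to at most \<open>N * C\<close>; this bounds all parameters.
  Outside a large box \<open>G\<close> is therefore at most \<open>e\<close>, and the deformation
  will not move the boundary of the disc.\<close>

lemma disc_bounded:
  assumes e: "0 < e"
  shows "\<exists>R>0. \<forall>w. e < G (disc q w) \<longrightarrow> (\<forall>k\<in>link_index. \<bar>w k\<bar> < R)"
proof -
  obtain C m R0 where C: "0 \<le> C" and R0: "0 \<le> R0"
    and fC: "\<And>j p. j < N \<Longrightarrow> f j p \<le> C"
    and KR: "\<And>x y z. (x, y, z) \<in> K \<Longrightarrow> norm x \<le> R0 \<and> norm y \<le> R0 \<and> \<bar>z\<bar> \<le> R0"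
    using bounds by metis
  define D where "D = sqrt (N * C)"
  have D: "0 \<le> D" using C by (simp add: D_def)
  define Y where "Y = R0 + 2 * D"
  define Z where "Z = R0 + N * (Y * D + C)"
  define R where "R = R0 + D + norm (fst (snd q)) + 2 * D + R0 + N * D + norm (fst q) + Z + \<bar>snd (snd q)\<bar> + 1"
  have Y: "0 \<le> Y" and Z: "0 \<le> Z" using R0 D C by (auto simp: Y_def Z_def)
  have ND: "0 \<le> N * D" using D by simp
  have "\<bar>w k\<bar> < R" if G: "e < G (disc q w)" and k: "k \<in> link_index" for w k
  proof -
    let ?u = "disc q w"
    let ?x = "fst ?u" and ?y = "fst (snd ?u)"
    have "\<exists>j<N. P ?u j \<in> K"
    proof (rule ccontr)
      assume "\<not> (\<exists>j<N. P ?u j \<in> K)"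
      then have "(\<Sum>j<N. f j (P ?u j)) = 0" using supp by (intro sum.neutral) auto
      moreover have "0 \<le> (\<Sum>j<N. (norm (pdiff w j))\<^sup>2)" by (intro sum_nonneg) auto
      ultimately show False using G e unfolding G_disc by linarith
    qed
    then obtain j where j: "j < N" "P ?u j \<in> K" by blast
    then have j0: "norm (?x j) \<le> R0" "norm (?y j) \<le> R0" "\<bar>height ?u j\<bar> \<le> R0"
      using KR unfolding P_def by auto
    have diff: "norm (pdiff w i) \<le> D" if "i < N" for i
    proof -
      have "(norm (pdiff w i))\<^sup>2 \<le> (\<Sum>j<N. (norm (pdiff w j))\<^sup>2)"
        using that by (intro member_le_sum[where f="\<lambda>j. (norm (pdiff w j))\<^sup>2"]) auto
      also have "\<dots> \<le> (\<Sum>j<N. f j (P ?u j))" using G e unfolding G_disc by linarith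
      also have "\<dots> \<le> (\<Sum>j<N. C)" using fC by (intro sum_mono) auto
      finally show ?thesis unfolding D_def by (intro real_le_rsqrt) simp
    qed
    have x: "norm (?x i) \<le> R0 + N * D" if "i < N" for i
    proof -
      have "norm (?x (i mod N)) \<le> norm (?x (j mod N)) + N * D"
        by (rule norm_chain[where g = "\<lambda>i. ?x (i mod N)"]) (use disc_diff[of _ q w] diff that j D in auto)
      then show ?thesis using that j j0 by simp
    qed
    have yeq: "?y i = fst (snd q) + pmean w - pdiff w i" if "i < N" for i
      using that by (simp add: disc_def)
    have mean: "norm (fst (snd q) + pmean w) \<le> R0 + D"
    proof -
      have "fst (snd q) + pmean w = ?y j + pdiff w j" using yeq[OF j(1)] by simp
      then show ?thesis
        using norm_triangle_ineq[of "?y j" "pdiff w j"] j0 diff[OF j(1)] by simp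
    qed
    have y: "norm (?y i) \<le> Y" if "i < N" for i
      unfolding yeq[OF that] Y_def
      using norm_triangle_ineq4[of "fst (snd q) + pmean w" "pdiff w i"] mean diff[OF that] by linarith
    have dzz: "norm (height ?u (Suc i) - height ?u i) \<le> Y * D + C" if i: "i < N" for i
    proof -
      have "\<bar>?y i \<bullet> pdiff w i\<bar> \<le> norm (?y i) * norm (pdiff w i)"
        by (rule Cauchy_Schwarz_ineq2)
      also have "\<dots> \<le> Y * D" using y[OF i] diff[OF i] Y by (intro mult_mono) auto
      finally show "norm (height ?u (Suc i) - height ?u i) \<le> Y * D + C"
        using fC[OF i, of "P ?u i"] nonneg[of i "P ?u i"] disc_diff[OF i, of q w] by (simp add: P_def)
    qed
    have "norm (height ?u 0) \<le> norm (height ?u j) + N * (Y * D + C)"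
      by (rule norm_chain[where g = "height (disc q w)", OF dzz]) (use j Y D C in auto)
    then have z: "\<bar>snd (snd ?u)\<bar> \<le> Z" using j0 by (simp add: Z_def)
    have R_ge: "R0 + D + norm (fst (snd q)) + 2 * D < R" "R0 + N * D + norm (fst q) < R" "Z + \<bar>snd (snd q)\<bar> < R"
      using R0 D ND Z unfolding R_def by (smt (verit) norm_ge_zero)+
    have pvec: "norm (pvec w i) < R" if "i < N" for i
    proof -
      have "pvec w i = (fst (snd q) + pmean w) - fst (snd q) - 2 *\<^sub>R pdiff w i"
        by (simp add: pdiff_def)
      then have "norm (pvec w i) \<le> norm (fst (snd q) + pmean w) + norm (fst (snd q)) + norm (2 *\<^sub>R pdiff w i)"
        by (metis (no_types, opaque_lifting) add_le_cancel_right norm_triangle_ineq4 order_trans)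
      also have "norm (2 *\<^sub>R pdiff w i) = 2 * norm (pdiff w i)" by simp
      finally show ?thesis using mean diff[OF that] R_ge by linarith
    qed
    have pvN: "norm (pvec w N) < R"
    proof -
      have "pvec w N = ?x 0 - fst q" using N by (simp add: disc_def)
      then show ?thesis using norm_triangle_ineq4[of "?x 0" "fst q"] x[OF N] R_ge by simp
    qed
    have "w None = snd (snd ?u) - snd (snd q)" by (simp add: disc_def)
    then have wN: "\<bar>w None\<bar> < R" using z R_ge by linarith
    have "\<bar>w (Some (i, l))\<bar> < R" if "i \<le> N" for i l
    proof -
      have "\<bar>pvec w i $ l\<bar> \<le> norm (pvec w i)" by (rule component_le_norm_cart)
      then show ?thesis using pvec[of i] pvN that by (cases "i = N") (auto simp: pvec_def)
    qed
    then show ?thesis using k wN unfolding link_index_def by auto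
  qed
  moreover have "0 < R" using R0 D ND Z unfolding R_def by (smt (verit) norm_ge_zero)
  ultimately show ?thesis by blast
qed

text \<open>On the zero set of \<open>link\<close> the functional is a sum of squared displacements
  and nonnegative values of the \<open>f j\<close>. Either some displacement is large, or the loop
  stays so close to \<open>q\<close> that \<open>f j0\<close> still has half of its value at
  \<open>q\<close>.\<close>

lemma link_lower:
  obtains e q where "0 < e" "\<And>u. (\<And>k. k \<in> link_index \<Longrightarrow> link q u k = 0) \<Longrightarrow> 3 * e \<le> G u"
proof -
  \<comment> \<open>Taking the first piece that is not identically 0 ensures that the heights up to
    corner \<open>j0\<close> receive no contribution from the \<open>f i\<close>.\<close>
  define j0 where "j0 = (LEAST j. j < N \<and> (\<exists>p. f j p \<noteq> 0))"
  have j0: "j0 < N" "\<exists>p. f j0 p \<noteq> 0" and j0_least: "\<And>i p. i < j0 \<Longrightarrow> f i p = 0"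
  proof -
    have "j0 < N \<and> (\<exists>p. f j0 p \<noteq> 0)"
      unfolding j0_def using LeastI_ex[of "\<lambda>j. j < N \<and> (\<exists>p. f j p \<noteq> 0)"] nontrivial by blast
    then show "j0 < N" "\<exists>p. f j0 p \<noteq> 0" by auto
    show "f i p = 0" if "i < j0" for i p
      using not_less_Least[of i "\<lambda>j. j < N \<and> (\<exists>p. f j p \<noteq> 0)"] that \<open>j0 < N\<close> unfolding j0_def
      by (meson order.strict_trans)
  qed
  obtain q where q: "f j0 q \<noteq> 0" using j0 by blast
  then have fq: "0 < f j0 q" using nonneg[of j0 q] by simp
  define h where "h = f j0 q / 2"
  have h: "0 < h" using fq by (simp add: h_def)
  have "isCont (f j0) q" using has_derivative_continuous[OF deriv] .
  then obtain d where d: "0 < d" "\<And>p. dist p q < d \<Longrightarrow> dist (f j0 p) (f j0 q) < h"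
    unfolding continuous_at_eps_delta using h by blast
  \<comment> \<open>If all displacements are at most \<open>s\<close>, corner \<open>j0\<close> is
    within \<open>L * s\<close> of \<open>q\<close>: the three summands account for the node, the
    momentum and the height.\<close>
  define L where "L = N + 1 + N * (norm (fst (snd q)) + 1)"
  have L: "1 \<le> L" unfolding L_def by (simp add: add_nonneg_nonneg)
  define s where "s = min 1 (d / (2 * L))"
  have s: "0 < s" "s \<le> 1" using d L by (auto simp: s_def)
  have sL: "L * s < d"
  proof -
    have "L * s \<le> L * (d / (2 * L))" using L by (intro mult_left_mono) (auto simp: s_def)
    then show ?thesis using L d by simp
  qed
  define e where "e = min (s\<^sup>2) h / 3"
  have "3 * e \<le> G u" if u: "\<And>k. k \<in> link_index \<Longrightarrow> link q u k = 0" for u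
  proof -
    define x where "x = fst u"
    define y where "y = fst (snd u)"
    define \<Delta> where "\<Delta> j = x (Suc j mod N) - x j" for j
    have y: "y j = fst (snd q) + \<Delta> j" if "j < N" for j
    proof -
      have "(y j - \<Delta> j - fst (snd q)) $ i = 0" for i
        using u[of "Some (j, i)"] that by (simp add: link_index_def link_def y_def x_def \<Delta>_def)
      then have "y j - \<Delta> j - fst (snd q) = 0" by (simp add: vec_eq_iff)
      then show ?thesis by (simp add: algebra_simps)
    qed
    have "(x 0 - fst q) $ i = 0" for i
      using u[of "Some (N, i)"] by (simp add: link_index_def link_def x_def)
    then have x0: "x 0 = fst q" by (simp add: vec_eq_iff)
    have z0: "height u 0 = snd (snd q)"
      using u[of None] by (simp add: link_index_def link_def)
    have sumD: "(\<Sum>j<N. \<Delta> j) = 0" unfolding \<Delta>_def by (rule sum_diff_0)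
    have "(\<Sum>j<N. y j \<bullet> \<Delta> j) = (\<Sum>j<N. fst (snd q) \<bullet> \<Delta> j + (norm (\<Delta> j))\<^sup>2)"
      by (rule sum.cong) (auto simp: y inner_add_left dot_square_norm)
    also have "\<dots> = (\<Sum>j<N. (norm (\<Delta> j))\<^sup>2)"
      using sumD by (simp add: sum.distrib flip: inner_sum_right)
    finally have G: "G u = (\<Sum>j<N. (norm (\<Delta> j))\<^sup>2) + (\<Sum>j<N. f j (P u j))"
      unfolding G_eq by (simp add: x_def y_def \<Delta>_def)
    have f0: "0 \<le> (\<Sum>j<N. f j (P u j))" using nonneg by (intro sum_nonneg) auto
    have D0: "0 \<le> (\<Sum>j<N. (norm (\<Delta> j))\<^sup>2)" by (intro sum_nonneg) auto
    show ?thesis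
    proof (cases "\<exists>j<N. s \<le> norm (\<Delta> j)")
      case True
      then obtain j where j: "j < N" "s \<le> norm (\<Delta> j)" by blast
      have "s\<^sup>2 \<le> (norm (\<Delta> j))\<^sup>2" using j s by (intro power_mono) auto
      also have "\<dots> \<le> (\<Sum>j<N. (norm (\<Delta> j))\<^sup>2)"
        using j by (intro member_le_sum[where f="\<lambda>j. (norm (\<Delta> j))\<^sup>2"]) auto
      finally show ?thesis using G f0 by (simp add: e_def)
    next
      case False
      then have D: "norm (\<Delta> j) \<le> s" if "j < N" for j using that by force
      have "x j0 - x 0 = (\<Sum>i<j0. \<Delta> i)"
      proof -
        have "x j - x 0 = (\<Sum>i<j. \<Delta> i)" if "j < N" for j
          using that by (induction j) (auto simp: \<Delta>_def algebra_simps)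
        then show ?thesis using j0 by blast
      qed
      also have "norm (\<Sum>i<j0. \<Delta> i) \<le> (\<Sum>i<j0. s)" using D j0 by (intro sum_norm_le) auto
      also have "\<dots> \<le> N * s" using j0 s by simp
      finally have dx: "norm (x j0 - fst q) \<le> N * s" using x0 by simp
      have dy: "norm (y j0 - fst (snd q)) \<le> s" using y[OF j0(1)] D[OF j0(1)] by simp
      have "height u j0 - snd (snd q) = (\<Sum>i<j0. y i \<bullet> \<Delta> i)"
        unfolding height_eq[of u j0] using z0 j0_least by (simp add: x_def y_def \<Delta>_def)
      also have "\<bar>\<Sum>i<j0. y i \<bullet> \<Delta> i\<bar> \<le> (\<Sum>i<j0. (norm (fst (snd q)) + 1) * s)"
      proof (intro order_trans[OF sum_abs] sum_mono)
        fix i assume "i \<in> {..<j0}"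
        then have i: "i < N" using j0 by simp
        have "norm (y i) \<le> norm (fst (snd q)) + 1"
          unfolding y[OF i] using norm_triangle_ineq[of "fst (snd q)" "\<Delta> i"] D[OF i] s by linarith
        then have "norm (y i) * norm (\<Delta> i) \<le> (norm (fst (snd q)) + 1) * s"
          using D[OF i] by (intro mult_mono) auto
        then show "\<bar>y i \<bullet> \<Delta> i\<bar> \<le> (norm (fst (snd q)) + 1) * s"
          using Cauchy_Schwarz_ineq2[of "y i" "\<Delta> i"] by linarith
      qed
      also have "\<dots> = j0 * ((norm (fst (snd q)) + 1) * s)" by simp
      also have "\<dots> \<le> N * ((norm (fst (snd q)) + 1) * s)"
        using j0 s by (intro mult_right_mono) auto
      finally have dheight: "\<bar>height u j0 - snd (snd q)\<bar> \<le> N * ((norm (fst (snd q)) + 1) * s)" .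
      have "norm (P u j0 - q) \<le> norm (x j0 - fst q) + (norm (y j0 - fst (snd q)) + norm (height u j0 - snd (snd q)))"
      proof -
        have "P u j0 - q = (x j0 - fst q, y j0 - fst (snd q), height u j0 - snd (snd q))"
          by (simp add: P_def x_def y_def prod_eq_iff)
        then show ?thesis
          using norm_Pair_le[of "x j0 - fst q" "(y j0 - fst (snd q), height u j0 - snd (snd q))"]
            norm_Pair_le[of "y j0 - fst (snd q)" "height u j0 - snd (snd q)"] by simp
      qed
      also have "\<dots> \<le> L * s" using dx dy dheight unfolding L_def by (simp add: algebra_simps)
      finally have "dist (P u j0) q < d" using sL by (simp add: dist_norm)
      then have "dist (f j0 (P u j0)) (f j0 q) < h" by (rule d)
      then have "h \<le> f j0 (P u j0)" unfolding h_def dist_real_def by linarith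
      also have "\<dots> \<le> (\<Sum>j<N. f j (P u j))"
        using j0 nonneg by (intro member_le_sum[where f="\<lambda>j. f j (P u j)"]) auto
      finally show ?thesis using G D0 by (simp add: e_def)
    qed
  qed
  moreover have "0 < e" using s h by (simp add: e_def)
  ultimately show ?thesis using that by blast
qed

text \<open>Without such a critical point the disc could be pushed below \<open>2 * e\<close> with
  its boundary fixed. By the Poincare-Miranda theorem the pushed disc still meets the zero set of
  \<open>link\<close>, where \<open>G\<close> is at least \<open>3 * e\<close>.\<close>

theorem positive_critical_point: "\<exists>u. 0 < G u \<and> S u = 0"
proof (rule ccontr)
  assume no: "\<not> (\<exists>u. 0 < G u \<and> S u = 0)"
  obtain e q where e: "0 < e" and low: "\<And>u. (\<And>k. k \<in> link_index \<Longrightarrow> link q u k = 0) \<Longrightarrow> 3 * e \<le> G u"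
    using link_lower by metis
  obtain d where d: "0 < d" "\<And>u. e \<le> G u \<Longrightarrow> d \<le> S u"
    using noncritical_uniform[OF e] no e by (meson less_le_trans)
  obtain R where R: "0 < R" "\<And>w k. e < G (disc q w) \<Longrightarrow> k \<in> link_index \<Longrightarrow> \<bar>w k\<bar> < R"
    using disc_bounded[OF e] by blast
  obtain r where r: "\<And>w. (\<And>k. \<bar>w k\<bar> \<le> R) \<Longrightarrow> disc q w \<in> cube r"
    using disc_in_cube by meson
  obtain T where T: "continuous_on UNIV T" "\<And>u. G u \<le> e \<Longrightarrow> T u = u" "\<And>u. u \<in> cube r \<Longrightarrow> G (T u) \<le> 2 * e"
    using deform[OF e d] by blast
  \<comment> \<open>On the faces of the box \<open>T\<close> does nothing and \<open>link\<close>
    inverts the parametrisation, so the sign conditions of the Poincare-Miranda theorem hold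
    trivially.\<close>
  have face: "link q (T (disc q w)) k = w k" if "k \<in> link_index" "\<bar>w k\<bar> = R" for w k
  proof -
    have "G (disc q w) \<le> e" using R(2)[of w k] that by force
    then show ?thesis using T(2) link_disc[OF that(1)] by simp
  qed
  have "\<exists>w. (\<forall>k. \<bar>w k\<bar> \<le> R) \<and> (\<forall>k\<in>link_index. link q (T (disc q w)) k = 0)"
  proof (rule poincare_miranda[OF finite_link_index R(1)])
    show "continuous_on UNIV (\<lambda>w. link q (T (disc q w)) k)" for k
      by (rule continuous_link, rule continuous_on_compose2[OF T(1) continuous_disc]) auto
  qed (use face R(1) in auto)
  then obtain w where w: "\<And>k. \<bar>w k\<bar> \<le> R" "\<And>k. k \<in> link_index \<Longrightarrow> link q (T (disc q w)) k = 0" by blast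
  have "3 * e \<le> G (T (disc q w))" by (rule low) (rule w(2))
  moreover have "G (T (disc q w)) \<le> 2 * e" by (rule T(3), rule r, rule w(1))
  ultimately have "3 * e \<le> 2 * e" by linarith
  then show False using e by simp
qed

text \<open>The vanishing of \<open>gy\<close> and \<open>gx\<close> gives the equations of a
  discrete orbit, and the vanishing of \<open>gz\<close> says that the conformal factors multiply to
  1.\<close>

theorem critical_orbit:
  "\<exists>x y z. x N = x 0 \<and> y N = y 0 \<and> z 0 < z N \<and> (\<Prod>j<N. 1 + c j (x j, y (Suc j), z j)) = 1 \<and>
     (\<forall>j<N. x (Suc j) = x j - b j (x j, y (Suc j), z j)
       \<and> (1 + c j (x j, y (Suc j), z j)) *\<^sub>R y j = y (Suc j) - a j (x j, y (Suc j), z j)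
       \<and> z (Suc j) = z j + y (Suc j) \<bullet> (x (Suc j) - x j) + f j (x j, y (Suc j), z j))"
proof -
  obtain u where G: "0 < G u" and S: "S u = 0" using positive_critical_point by blast
  have gx0: "gx u j = 0" and gy0: "gy u j = 0" if "j < N" for j
    using S_bounds[OF that, of u] S by auto
  have gz0: "gz u = 0" using S_bound_gz[of u] S by simp
  define x where "x j = fst u (j mod N)" for j
  \<comment> \<open>Undoes the storage convention: entry \<open>j\<close> of the momenta is
    \<open>y (Suc j)\<close>, and closing the loop makes the last entry serve as
    \<open>y 0\<close>.\<close>
  define y where "y j = (case j of 0 \<Rightarrow> fst (snd u) (N - 1) | Suc i \<Rightarrow> fst (snd u) i)" for j
  have P: "P u j = (x j, y (Suc j), height u j)" if "j < N" for j
    using that by (simp add: P_def x_def y_def)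
  have 0: "lam u 0 = 1" using gz0 by (simp add: gz_def)
  have 1: "x (Suc j) = x j - b j (P u j)" if "j < N" for j
  proof -
    have "lam u (Suc j) *\<^sub>R (x (Suc j) - x j + b j (P u j)) = 0"
      using gy0[OF that] that by (simp add: gy_def x_def)
    then have "x (Suc j) - x j + b j (P u j) = 0" using lam_pos[of u "Suc j"] by simp
    then show ?thesis by (simp add: algebra_simps eq_neg_iff_add_eq_0)
  qed
  have 2: "(1 + c j (P u j)) *\<^sub>R y j = y (Suc j) - a j (P u j)" if "j < N" for j
  proof -
    \<comment> \<open>Criticality in the height gives \<open>lam u 0 = 1\<close>, so the exceptional
      weight at node 0 agrees with the general one.\<close>
    have l: "(if j = 0 then 1 else lam u j) = lam u j" using 0 by simp
    have "fst (snd u) ((j + N - 1) mod N) = y j"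
      using that by (cases j) (auto simp: y_def)
    then have "lam u j *\<^sub>R y j + lam u (Suc j) *\<^sub>R (a j (P u j) - y (Suc j)) = 0"
      using gx0[OF that] unfolding gx_def l by (simp add: y_def)
    then have "lam u (Suc j) *\<^sub>R ((1 + c j (P u j)) *\<^sub>R y j + (a j (P u j) - y (Suc j))) = 0"
      unfolding lam_Suc[OF that] by (simp add: algebra_simps)
    then have "(1 + c j (P u j)) *\<^sub>R y j + (a j (P u j) - y (Suc j)) = 0"
      using lam_pos[of u "Suc j"] by simp
    then show ?thesis by (simp add: algebra_simps eq_neg_iff_add_eq_0)
  qed
  have 3: "height u (Suc j) = height u j + y (Suc j) \<bullet> (x (Suc j) - x j) + f j (P u j)" if "j < N" for j
    using that by (simp add: P_def x_def y_def)
  have 4: "(\<Prod>j<N. 1 + c j (P u j)) = 1"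
    using 0 by (simp add: lam_def atLeast0LessThan)
  have "x N = x 0" "y N = y 0" using N by (auto simp: x_def y_def split: nat.splits)
  moreover have "height u 0 < height u N" using G by (simp add: G_def)
  ultimately show ?thesis
    using 1 2 3 4 P by (intro exI[of _ x] exI[of _ y] exI[of _ "height u"]) auto
qed

end

section \<open>Contact isotopies\<close>

lemma smooth_has_derivative:
  "smooth f \<Longrightarrow> (f has_derivative frechet_derivative f (at x)) (at x)"
  by (erule smooth.cases) (simp add: frechet_derivative_works)

lemma smooth_partial: "smooth f \<Longrightarrow> smooth (\<lambda>x. frechet_derivative f (at x) v)"
  by (erule smooth.cases) simp

lemma smooth_continuous_on: "smooth f \<Longrightarrow> continuous_on S f"
  by (intro continuous_at_imp_continuous_on ballI has_derivative_continuous[OF smooth_has_derivative])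

lemma smooth_linear: "smooth f \<Longrightarrow> linear (frechet_derivative f (at x))"
  using has_derivative_linear[OF smooth_has_derivative] .

text \<open>Smoothness controls the derivative only in fixed directions; expanding the vector in a
  basis gives joint continuity in point and vector.\<close>

lemma smooth_continuous_derivative:
  fixes f :: "'a::euclidean_space \<Rightarrow> 'b::real_normed_vector"
  assumes f: "smooth f" and u: "continuous_on A u" and v: "continuous_on A v"
  shows "continuous_on A (\<lambda>t. frechet_derivative f (at (u t)) (v t))"
proof -
  have eq: "frechet_derivative f (at x) w = (\<Sum>b\<in>Basis. (w \<bullet> b) *\<^sub>R frechet_derivative f (at x) b)" for x w
  proof -
    interpret linear "frechet_derivative f (at x)" using smooth_linear[OF f] .
    have "frechet_derivative f (at x) w = frechet_derivative f (at x) (\<Sum>b\<in>Basis. (w \<bullet> b) *\<^sub>R b)"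
      by (simp add: euclidean_representation)
    then show ?thesis by (simp add: sum scale)
  qed
  have "continuous_on A (\<lambda>t. frechet_derivative f (at (u t)) b)" for b
    using continuous_on_compose2[OF smooth_continuous_on[OF smooth_partial[OF f]] u] by blast
  then have 1: "continuous_on A (\<lambda>t. \<Sum>b\<in>Basis. (v t \<bullet> b) *\<^sub>R frechet_derivative f (at (u t)) b)"
    by (intro continuous_intros v)
  have 2: "(\<lambda>t. frechet_derivative f (at (u t)) (v t)) =
      (\<lambda>t. \<Sum>b\<in>Basis. (v t \<bullet> b) *\<^sub>R frechet_derivative f (at (u t)) b)"
    by (rule ext) (rule eq)
  show ?thesis by (subst 2) (rule 1)
qed

text \<open>Since \<open>F' = L \<circ> M'\<close> is known in advance, no derivative of the inverse of \<open>M\<close> is needed.\<close>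
lemma expansive_pushforward_derivative:
  fixes M :: "'a::real_normed_vector \<Rightarrow> 'b::real_normed_vector" and F :: "'a \<Rightarrow> 'c::real_normed_vector"
  assumes F: "(F has_derivative F') (at x within S)" and M: "(M has_derivative M') (at x within S)"
    and L: "bounded_linear L" and FL: "\<And>v. F' v = L (M' v)" and "x \<in> S"
    and expansive: "\<And>y. y \<in> S \<Longrightarrow> norm (y - x) \<le> C * norm (M y - M x)"
    and f: "\<And>y. y \<in> S \<Longrightarrow> f (M y) = F y"
  shows "(f has_derivative L) (at (M x) within M ` S)"
proof -
  \<comment> \<open>\<open>F - L \<circ> M\<close> has derivative 0 at \<open>x\<close>, so its
    increment is small against \<open>y - x\<close>, and by expansiveness also against
    \<open>M y - M x\<close>.\<close>
  have "((\<lambda>y. F y - L (M y)) has_derivative (\<lambda>v. F' v - L (M' v))) (at x within S)"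
    by (intro has_derivative_diff F bounded_linear.has_derivative[OF L M])
  then have "((\<lambda>y. F y - L (M y)) has_derivative (\<lambda>v. 0)) (at x within S)"
    by (simp add: FL)
  then have small: "\<exists>d>0. \<forall>y\<in>S. norm (y - x) < d \<longrightarrow>
      norm (F y - L (M y) - (F x - L (M x))) \<le> e * norm (y - x)" if "0 < e" for e
    using that unfolding has_derivative_within_alt by simp
  interpret L: bounded_linear L by (rule L)
  define B where "B = max C 1"
  have B: "0 < B" by (simp add: B_def)
  have exp: "norm (y - x) \<le> B * norm (M y - M x)" if "y \<in> S" for y
  proof -
    have "C * norm (M y - M x) \<le> B * norm (M y - M x)" by (intro mult_right_mono) (auto simp: B_def)
    then show ?thesis using expansive[OF that] by linarith
  qed
  show ?thesis
    unfolding has_derivative_within_alt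
  proof (intro conjI allI impI)
    fix e :: real assume e: "0 < e"
    then obtain d where d: "0 < d" and dS: "\<And>y. y \<in> S \<Longrightarrow> norm (y - x) < d \<Longrightarrow>
      norm (F y - L (M y) - (F x - L (M x))) \<le> e / B * norm (y - x)"
      using small[of "e / B"] B by auto
    have "norm (f w - f (M x) - L (w - M x)) \<le> e * norm (w - M x)"
      if w: "w \<in> M ` S" and wd: "norm (w - M x) < d / B" for w
    proof -
      obtain y where y: "y \<in> S" "w = M y" using w by blast
      have "B * norm (M y - M x) < d" using wd y B by (simp add: field_simps)
      then have "norm (y - x) < d" using exp[OF y(1)] by linarith
      then have "norm (F y - L (M y) - (F x - L (M x))) \<le> e / B * norm (y - x)" by (rule dS[OF y(1)])
      also have "\<dots> \<le> e / B * (B * norm (M y - M x))"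
        using exp[OF y(1)] e B by (intro mult_left_mono) auto
      also have "\<dots> = e * norm (w - M x)" using B y by simp
      finally show ?thesis using f y \<open>x \<in> S\<close> by (simp add: L.diff algebra_simps)
    qed
    then show "\<exists>d>0. \<forall>w\<in>M ` S. norm (w - M x) < d \<longrightarrow>
        norm (f w - f (M x) - L (w - M x)) \<le> e * norm (w - M x)"
      using d B by (intro exI[of _ "d / B"]) auto
  qed (rule L)
qed

text \<open>A solution of \<open>T q = p\<close> is a fixed point of
  \<open>q \<mapsto> p - (T q - q)\<close>, a contraction with constant 1/2.\<close>

lemma perturbed_identity_surj:
  fixes T :: "'a::euclidean_space \<Rightarrow> 'a"
  assumes "\<And>q q'. norm ((T q - q) - (T q' - q')) \<le> norm (q - q') / 2"
  shows "\<exists>q. T q = p"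
proof -
  have "\<exists>!q. p - (T q - q) = q"
  proof (rule banach_fix_type[of "1/2"])
    show "\<forall>x y. dist (p - (T x - x)) (p - (T y - y)) \<le> 1 / 2 * dist x y"
    proof (intro allI)
      fix x y
      have *: "(p - (T x - x)) - (p - (T y - y)) = (T y - y) - (T x - x)" by simp
      then show "dist (p - (T x - x)) (p - (T y - y)) \<le> 1 / 2 * dist x y"
        unfolding dist_norm * using assms[of y x] by (simp add: norm_minus_commute[of x y])
    qed
  qed auto
  then obtain q where "p - (T q - q) = q" by blast
  then have "T q = p" by (simp add: algebra_simps)
  then show ?thesis by blast
qed

lemma perturbed_identity_expansive:
  fixes T :: "'a::real_normed_vector \<Rightarrow> 'a"
  assumes "norm ((T q - q) - (T q' - q')) \<le> norm (q - q') / 2"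
  shows "norm (q - q') \<le> 2 * norm (T q - T q')"
proof -
  have "q - q' = (T q - T q') - ((T q - q) - (T q' - q'))" by simp
  then have "norm (q - q') \<le> norm (T q - T q') + norm ((T q - q) - (T q' - q'))"
    by (metis norm_triangle_ineq4)
  then show ?thesis using assms by linarith
qed

lemma alpha_z: "alpha q (0, 0, r) = r"
  by (simp add: alpha_def)

lemma alpha_add: "alpha q (v + w) = alpha q v + alpha q w"
  by (simp add: alpha_def inner_add_right)

lemma alpha_scale: "alpha q (r *\<^sub>R v) = r * alpha q v"
  by (simp add: alpha_def algebra_simps)

text \<open>Evaluation on the Reeb direction, where \<open>alpha\<close> equals 1, determines the
  factor; this makes the definite description in \<open>gfun\<close> meaningful.\<close>

lemma pullback_factor_unique:
  assumes "pullback_factor \<psi> g" "pullback_factor \<psi> g'"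
  shows "g = g'"
proof
  fix q
  have "exp (g q) * alpha q (0, 0, 1) = exp (g' q) * alpha q (0, 0, 1)"
    using assms unfolding pullback_factor_def by metis
  then show "g q = g' q" by (simp add: alpha_z)
qed

lemma gfun_eq:
  assumes "pullback_factor \<psi> g"
  shows "gfun \<psi> = g"
  unfolding gfun_def by (rule the_equality) (use assms pullback_factor_unique in blast)+

lemma pullback_gfun: "contactomorphism \<psi> \<Longrightarrow> pullback_factor \<psi> (gfun \<psi>)"
  unfolding contactomorphism_def using gfun_eq by metis

lemma smooth_gfun: "contactomorphism \<psi> \<Longrightarrow> smooth (gfun \<psi>)"
  unfolding contactomorphism_def using gfun_eq by metis

section \<open>Derivatives of the isotopy and uniform estimates\<close>

locale isotopy =
  fixes \<Phi> :: "real \<times> 'n::finite pt \<Rightarrow> 'n pt" and K :: "'n pt set"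
  assumes smooth: "smooth \<Phi>"
    and at_0: "\<And>q. \<Phi> (0, q) = q"
    and contact: "\<And>t. t \<in> {0..1} \<Longrightarrow> contactomorphism (\<lambda>q. \<Phi> (t, q))"
    and compact_K: "compact K"
    and off_K: "\<And>t q. t \<in> {0..1} \<Longrightarrow> q \<notin> K \<Longrightarrow> \<Phi> (t, q) = q"
    and positive: "\<And>t p. t \<in> {0..1} \<Longrightarrow> p \<in> interior (closure {p. contact_hamiltonian \<Phi> t p \<noteq> 0}) \<Longrightarrow>
        0 < contact_hamiltonian \<Phi> t p"
begin

text \<open>Joint differential in time and space: \<open>D p (1, 0)\<close> is the velocity and
  \<open>D p (0, v)\<close> the spatial differential applied to \<open>v\<close>.\<close>

definition D :: "real \<times> 'n pt \<Rightarrow> real \<times> 'n pt \<Rightarrow> 'n pt" where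
  "D p v = frechet_derivative \<Phi> (at p) v"

definition inv_flow :: "real \<Rightarrow> 'n pt \<Rightarrow> 'n pt" where
  "inv_flow t = inv (\<lambda>q. \<Phi> (t, q))"

definition DI :: "real \<Rightarrow> 'n pt \<Rightarrow> 'n pt \<Rightarrow> 'n pt" where
  "DI t q v = frechet_derivative (inv_flow t) (at q) v"

definition E :: "real \<Rightarrow> 'n pt \<Rightarrow> real" where
  "E t q = exp (gfun (\<lambda>q. \<Phi> (t, q)) q)"

lemma D_deriv: "(\<Phi> has_derivative D p) (at p)"
  using smooth_has_derivative[OF smooth, of p] by (simp add: D_def[abs_def])

lemma D_linear: "linear (D p)"
  using has_derivative_linear[OF D_deriv] .

lemma D_split: "D p (r, v) = r *\<^sub>R D p (1, 0) + D p (0, v)"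
proof -
  interpret linear "D p" by (rule D_linear)
  have "D p (r, v) = D p (r *\<^sub>R (1, 0) + (0, v))" by simp
  also have "\<dots> = r *\<^sub>R D p (1, 0) + D p (0, v)" by (simp only: add scale)
  finally show ?thesis .
qed

lemma D_zero: "D p (0, 0) = 0"
  using linear_0[OF D_linear[of p]] by (simp add: zero_prod_def)

lemma D_scale: "D p (0, r *\<^sub>R v) = r *\<^sub>R D p (0, v)" "D p (r, 0) = r *\<^sub>R D p (1, 0)"
  using linear_scale[OF D_linear[of p], of r "(0, v)"] linear_scale[OF D_linear[of p], of r "(1, 0)"]
  by simp_all

lemma continuous_D:
  "continuous_on A u \<Longrightarrow> continuous_on A v \<Longrightarrow> continuous_on A (\<lambda>t. D (u t) (v t))"
  unfolding D_def by (rule smooth_continuous_derivative[OF smooth])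

lemma inv_flow_inverse:
  assumes "t \<in> {0..1}"
  shows "\<Phi> (t, inv_flow t q) = q" "inv_flow t (\<Phi> (t, q)) = q"
proof -
  have "bij (\<lambda>q. \<Phi> (t, q))" using contact[OF assms] by (simp add: contactomorphism_def)
  then show "\<Phi> (t, inv_flow t q) = q" "inv_flow t (\<Phi> (t, q)) = q"
    unfolding inv_flow_def using surj_f_inv_f[of "\<lambda>q. \<Phi> (t, q)" q] inv_f_f[of "\<lambda>q. \<Phi> (t, q)" q]
    by (auto simp: bij_def)
qed

lemma inv_flow_smooth: "t \<in> {0..1} \<Longrightarrow> smooth (inv_flow t)"
  using contact[of t] by (simp add: contactomorphism_def inv_flow_def)

lemma DI_deriv: "t \<in> {0..1} \<Longrightarrow> (inv_flow t has_derivative DI t q) (at q)"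
  using smooth_has_derivative[OF inv_flow_smooth, of t q] by (simp add: DI_def[abs_def])

lemma D_space: "((\<lambda>q. \<Phi> (t, q)) has_derivative (\<lambda>v. D (t, q) (0, v))) (at q)"
proof -
  have "((\<lambda>q :: 'n pt. (t, q)) has_derivative (\<lambda>v. (0, v))) (at q)"
    by (auto intro!: derivative_eq_intros)
  from has_derivative_compose[OF this D_deriv] show ?thesis by simp
qed

lemma D_DI:
  assumes t: "t \<in> {0..1}"
  shows "D (t, inv_flow t q) (0, DI t q v) = v"
proof -
  have "((\<lambda>q. \<Phi> (t, inv_flow t q)) has_derivative (\<lambda>v. D (t, inv_flow t q) (0, DI t q v))) (at q)"
    by (rule has_derivative_compose[OF DI_deriv[OF t] D_space])
  then have "((\<lambda>q. q) has_derivative (\<lambda>v. D (t, inv_flow t q) (0, DI t q v))) (at q)"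
    by (simp add: inv_flow_inverse[OF t])
  from has_derivative_unique[OF this has_derivative_ident] show ?thesis by meson
qed

lemma DI_D:
  assumes t: "t \<in> {0..1}"
  shows "DI t (\<Phi> (t, q)) (D (t, q) (0, v)) = v"
proof -
  have "((\<lambda>q. inv_flow t (\<Phi> (t, q))) has_derivative (\<lambda>v. DI t (\<Phi> (t, q)) (D (t, q) (0, v)))) (at q)"
    by (rule has_derivative_compose[OF D_space DI_deriv[OF t]])
  then have "((\<lambda>q. q) has_derivative (\<lambda>v. DI t (\<Phi> (t, q)) (D (t, q) (0, v)))) (at q)"
    by (simp add: inv_flow_inverse[OF t])
  from has_derivative_unique[OF this has_derivative_ident] show ?thesis by meson
qed

lemma D_off:
  assumes t: "t \<in> {0..1}" and q: "q \<notin> K"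
  shows "D (t, q) (0, v) = v"
proof -
  have "((\<lambda>q. \<Phi> (t, q)) has_derivative (\<lambda>v. v)) (at q)"
    by (rule has_derivative_transform_within_open[OF has_derivative_ident, of "- K"])
       (use q off_K[OF t] compact_imp_closed[OF compact_K] in auto)
  from has_derivative_unique[OF D_space this] show ?thesis by meson
qed

lemma inv_flow_off:
  assumes t: "t \<in> {0..1}" and q: "q \<notin> K"
  shows "inv_flow t q = q"
  using inv_flow_inverse(2)[OF t, of q] off_K[OF t q] by simp

lemma alpha_D:
  assumes t: "t \<in> {0..1}"
  shows "alpha (\<Phi> (t, q)) (D (t, q) (0, v)) = E t q * alpha q v"
proof -
  have "frechet_derivative (\<lambda>q. \<Phi> (t, q)) (at q) = (\<lambda>v. D (t, q) (0, v))"
    using frechet_derivative_at[OF D_space] by simp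
  then show ?thesis
    using pullback_gfun[OF contact[OF t]] unfolding pullback_factor_def E_def by metis
qed

lemma E_pos: "0 < E t q" by (simp add: E_def)

lemma continuous_E: "t \<in> {0..1} \<Longrightarrow> continuous_on UNIV (E t)"
  unfolding E_def[abs_def]
  by (intro continuous_on_exp smooth_continuous_on smooth_gfun contact)

lemma E_0: "E 0 q = 1"
proof -
  have "D (0, q) (0, v) = v" for v
  proof -
    have "((\<lambda>q. q) has_derivative (\<lambda>v. D (0, q) (0, v))) (at q)"
      using D_space[of 0 q] by (simp add: at_0)
    from has_derivative_unique[OF this has_derivative_ident] show ?thesis by meson
  qed
  then show ?thesis using alpha_D[of 0 q "(0, 0, 1)"] by (simp add: at_0 alpha_z)
qed

lemma hamiltonian_eq:
  assumes t: "t \<in> {0..1}"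
  shows "contact_hamiltonian \<Phi> t p = alpha p (D (t, inv_flow t p) (1, 0))"
  unfolding contact_hamiltonian_def D_def inv_flow_def ..

text \<open>By continuity the set where the Hamiltonian is nonzero is open, hence inside the
  interior of its closure, where positivity is assumed. So the Hamiltonian is everywhere zero or
  positive.\<close>

lemma hamiltonian_nonneg:
  assumes t: "t \<in> {0..1}"
  shows "0 \<le> alpha (\<Phi> (t, q)) (D (t, q) (1, 0))"
proof -
  define p where "p = \<Phi> (t, q)"
  have eq: "contact_hamiltonian \<Phi> t = (\<lambda>p. alpha p (D (t, inv_flow t p) (1, 0)))"
    using hamiltonian_eq[OF t] by blast
  have c: "continuous_on UNIV (\<lambda>p. D (t, inv_flow t p) (1, 0))"
    by (intro continuous_D continuous_intros smooth_continuous_on inv_flow_smooth t)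
  have "continuous_on UNIV (contact_hamiltonian \<Phi> t)"
    unfolding eq alpha_def by (intro continuous_intros c)
  then have "open {p. contact_hamiltonian \<Phi> t p \<noteq> 0}"
    by (intro open_Collect_neq continuous_on_const)
  then have "{p. contact_hamiltonian \<Phi> t p \<noteq> 0} \<subseteq> interior (closure {p. contact_hamiltonian \<Phi> t p \<noteq> 0})"
    by (simp add: interior_maximal closure_subset)
  then have "0 \<le> contact_hamiltonian \<Phi> t p"
    using positive[OF t, of p] by (cases "contact_hamiltonian \<Phi> t p = 0") auto
  then show ?thesis
    unfolding hamiltonian_eq[OF t] p_def by (simp add: inv_flow_inverse[OF t])
qed

text \<open>The spatial differential is injective, so compactness of times, \<open>K\<close> and the
  unit sphere gives a uniform bound there; off \<open>K\<close> the differential is the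
  identity.\<close>

lemma D_lower_bound: "\<exists>m>0. \<forall>t\<in>{0..1}. \<forall>q v. m * norm v \<le> norm (D (t, q) (0, v))"
proof -
  define A where "A = {0..1::real} \<times> K \<times> sphere (0 :: 'n pt) 1"
  define g where "g = (\<lambda>(t, q, v). norm (D (t, q) (0, v)))"
  have compA: "compact A" unfolding A_def by (intro compact_Times compact_K) auto
  have contg: "continuous_on A g"
    unfolding g_def case_prod_beta by (intro continuous_intros continuous_D)
  have gpos: "0 < g a" if "a \<in> A" for a
  proof -
    obtain t q v where a: "a = (t, q, v)" by (cases a)
    have t: "t \<in> {0..1}" and v: "norm v = 1" using that by (auto simp: A_def a)
    have "D (t, q) (0, v) \<noteq> 0"
    proof
      assume "D (t, q) (0, v) = 0"
      then have "v = DI t (\<Phi> (t, q)) 0" using DI_D[OF t, of q v] by simp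
      also have "\<dots> = 0" using has_derivative_linear[OF DI_deriv[OF t]] linear_0 by blast
      finally show False using v by simp
    qed
    then show ?thesis by (simp add: g_def a)
  qed
  \<comment> \<open>The cap \<open>m \<le> 1\<close> serves the points off \<open>K\<close>, where
    vectors keep their length.\<close>
  obtain m where m: "0 < m" "m \<le> 1" "\<And>a. a \<in> A \<Longrightarrow> m \<le> g a"
  proof (cases "A = {}")
    case True
    then show ?thesis using that[of 1] by auto
  next
    case False
    obtain a0 where "a0 \<in> A" "\<And>a. a \<in> A \<Longrightarrow> g a0 \<le> g a"
      using continuous_attains_inf[OF compA False contg] by blast
    then show ?thesis using that[of "min 1 (g a0)"] gpos by (meson min.cobounded1 min.coboundedI2 min_less_iff_conj zero_less_one)
  qed
  have "m * norm v \<le> norm (D (t, q) (0, v))" if t: "t \<in> {0..1}" for t q v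
  proof (cases "q \<in> K \<and> v \<noteq> 0")
    case True
    define w where "w = v /\<^sub>R norm v"
    have "(t, q, w) \<in> A" using t True by (simp add: A_def w_def)
    from m(3)[OF this] have "m \<le> norm (D (t, q) (0, w))" by (simp add: g_def)
    moreover have "D (t, q) (0, v) = norm v *\<^sub>R D (t, q) (0, w)"
      unfolding D_scale(1)[symmetric] using True by (simp add: w_def)
    ultimately show ?thesis by (simp add: mult.commute[of _ "norm v"] mult_left_mono)
  next
    case False
    then show ?thesis using D_off[OF t, of q v] m by (auto simp: D_zero mult_left_le_one_le)
  qed
  then show ?thesis using m by blast
qed

lemma D_uniform:
  assumes e: "0 < e"
  shows "\<exists>h>0. \<forall>t\<in>{0..1}. \<forall>t'\<in>{0..1}. \<bar>t' - t\<bar> < h \<longrightarrow>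
     (\<forall>q v. norm (D (t', q) (0, v) - D (t, q) (0, v)) \<le> e * norm v)"
proof -
  define A where "A = {0..1::real} \<times> K \<times> sphere (0 :: 'n pt) 1"
  define g where "g = (\<lambda>(t, q, v). D (t, q) (0, v))"
  have compA: "compact A" unfolding A_def by (intro compact_Times compact_K) auto
  have contg: "continuous_on A g"
    unfolding g_def case_prod_beta by (intro continuous_intros continuous_D)
  obtain h where h: "0 < h" "\<And>a a'. a \<in> A \<Longrightarrow> a' \<in> A \<Longrightarrow> dist a' a < h \<Longrightarrow> dist (g a') (g a) < e"
    using compact_uniformly_continuous[OF contg compA] e unfolding uniformly_continuous_on_def by meson
  have "norm (D (t', q) (0, v) - D (t, q) (0, v)) \<le> e * norm v"
    if t: "t \<in> {0..1}" "t' \<in> {0..1}" "\<bar>t' - t\<bar> < h" for t t' q v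
  proof (cases "q \<in> K \<and> v \<noteq> 0")
    case True
    define w where "w = v /\<^sub>R norm v"
    have 1: "(t, q, w) \<in> A" "(t', q, w) \<in> A" using t True by (auto simp: A_def w_def)
    have 2: "dist (t', q, w) (t, q, w) < h" using t by (simp add: dist_Pair_Pair dist_real_def)
    have "norm (D (t', q) (0, w) - D (t, q) (0, w)) < e"
      using h(2)[OF 1 2] by (simp add: g_def dist_norm)
    moreover have "D (s, q) (0, v) = norm v *\<^sub>R D (s, q) (0, w)" for s
      unfolding D_scale(1)[symmetric] using True by (simp add: w_def)
    ultimately show ?thesis
      by (simp add: mult.commute[of _ "norm v"] mult_left_mono flip: scaleR_diff_right)
  next
    case False
    then show ?thesis using D_off[OF t(1), of q v] D_off[OF t(2), of q v] e by (auto simp: D_zero)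
  qed
  then show ?thesis using h by blast
qed

lemma time_lipschitz: "\<exists>B\<ge>0. \<forall>s\<in>{0..1}. \<forall>t\<in>{0..1}. \<forall>q. norm (\<Phi> (s, q) - \<Phi> (t, q)) \<le> B * \<bar>s - t\<bar>"
proof -
  have "continuous_on ({0..1} \<times> K) (\<lambda>p. D p (1, 0))"
    by (intro continuous_D continuous_intros)
  then have "bounded ((\<lambda>p. D p (1, 0)) ` ({0..1} \<times> K))"
    by (intro compact_imp_bounded compact_continuous_image compact_Times compact_K) auto
  then obtain B where B0: "\<forall>w\<in>(\<lambda>p. D p (1, 0)) ` ({0..1} \<times> K). norm w \<le> B"
    unfolding bounded_iff by blast
  have B: "norm (D (t, q) (1, 0)) \<le> B" if "t \<in> {0..1}" "q \<in> K" for t q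
    using B0[rule_format, OF imageI[of "(t, q)"]] that by simp
  have "norm (\<Phi> (s, q) - \<Phi> (t, q)) \<le> max 0 B * \<bar>s - t\<bar>" if s: "s \<in> {0..1}" and t: "t \<in> {0..1}" for s t q
  proof (cases "q \<in> K")
    case True
    have der: "((\<lambda>t. \<Phi> (t, q)) has_derivative (\<lambda>r. D (t, q) (r, 0))) (at t within {0..1})" for t
    proof -
      have "((\<lambda>t. (t, q)) has_derivative (\<lambda>r. (r, 0))) (at t within {0..1})"
        by (auto intro!: derivative_eq_intros)
      from has_derivative_compose[OF this D_deriv] show ?thesis by simp
    qed
    have "norm (\<Phi> (s, q) - \<Phi> (t, q)) \<le> max 0 B * norm (s - t)"
    proof (rule differentiable_bound[OF _ der _ s t])
      fix t :: real assume t: "t \<in> {0..1}"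
      show "onorm (\<lambda>r. D (t, q) (r, 0)) \<le> max 0 B"
      proof (rule onorm_le)
        fix r
        have "norm (D (t, q) (r, 0)) = \<bar>r\<bar> * norm (D (t, q) (1, 0))"
          by (subst D_scale(2)) simp
        also have "\<dots> \<le> \<bar>r\<bar> * max 0 B" using B[OF t True] by (intro mult_left_mono) auto
        finally show "norm (D (t, q) (r, 0)) \<le> max 0 B * norm r" by (simp add: mult.commute)
      qed
    qed auto
    then show ?thesis by simp
  qed (use off_K s t in auto)
  then show ?thesis by (intro exI[of _ "max 0 B"]) auto
qed

section \<open>Generating functions\<close>

definition transit :: "real \<Rightarrow> real \<Rightarrow> 'n pt \<Rightarrow> 'n pt" where
  "transit s t q = \<Phi> (t, inv_flow s q)"

text \<open>Passage from \<open>(x, y, z)\<close> to the coordinates \<open>(x, Y, z)\<close> in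
  which the generating function lives.\<close>

definition mixed :: "real \<Rightarrow> real \<Rightarrow> 'n pt \<Rightarrow> 'n pt" where
  "mixed s t q = (fst q, fst (snd (transit s t q)), snd (snd q))"

definition gen_value :: "real \<Rightarrow> real \<Rightarrow> 'n pt \<Rightarrow> real" where
  "gen_value s t q = snd (snd (transit s t q)) - snd (snd q) - fst (snd (transit s t q)) \<bullet> (fst (transit s t q) - fst q)"

definition gen_fun :: "real \<Rightarrow> real \<Rightarrow> 'n pt \<Rightarrow> real" where
  "gen_fun s t p = gen_value s t (inv (mixed s t) p)"

text \<open>The transition map differs from the identity by a map with Lipschitz constant 1/2; this
  property passes to \<open>mixed\<close> and makes it invertible.\<close>

definition short_step :: "real \<Rightarrow> real \<Rightarrow> bool" where
  "short_step s u \<longleftrightarrow> s \<in> {0..1} \<and> u \<in> {0..1} \<and> s \<le> u \<and>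
    (\<forall>t\<in>{s..u}. \<forall>q q'. norm ((transit s t q - q) - (transit s t q' - q')) \<le> norm (q - q') / 2)"

definition ham_at :: "real \<Rightarrow> real \<Rightarrow> 'n pt \<Rightarrow> real" where
  "ham_at s t q = alpha (transit s t q) (D (t, inv_flow s q) (1, 0))"

definition conf_factor :: "real \<Rightarrow> real \<Rightarrow> 'n pt \<Rightarrow> real" where
  "conf_factor s t q = E t (inv_flow s q) / E s (inv_flow s q)"

text \<open>The differential of the generating function in the variables
  \<open>(t, x, Y, z)\<close>: with \<open>e\<close> the conformal factor it is
  \<open>H dt + (Y - e y) dx + (x - X) dY + (e - 1) dz\<close>.\<close>

definition lform :: "real \<Rightarrow> real \<Rightarrow> 'n pt \<Rightarrow> real \<times> 'n pt \<Rightarrow> real" where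
  "lform s t q w = fst w * ham_at s t q + conf_factor s t q * (snd (snd (snd w)) - fst (snd q) \<bullet> fst (snd w))
     - snd (snd (snd w)) + fst (snd (transit s t q)) \<bullet> fst (snd w)
     - (fst (transit s t q) - fst q) \<bullet> fst (snd (snd w))"

text \<open>The differential of the transition map minus the identity is the difference of the
  differentials at times \<open>t\<close> and \<open>s\<close>, composed with \<open>DI s q\<close>.
  The latter has norm at most \<open>1 / m\<close>, so closeness within \<open>m / 2\<close> gives
  the constant 1/2.\<close>

lemma small_steps: "\<exists>h>0. \<forall>s u. s \<in> {0..1} \<longrightarrow> u \<in> {0..1} \<longrightarrow> s \<le> u \<longrightarrow> u - s < h \<longrightarrow> short_step s u"
proof -
  obtain m where m: "0 < m" "\<And>t q v. t \<in> {0..1} \<Longrightarrow> m * norm v \<le> norm (D (t, q) (0, v))"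
    using D_lower_bound by blast
  have "0 < m / 2" using m by simp
  from D_uniform[OF this] obtain h where h: "0 < h"
    "\<And>t t' q v. t \<in> {0..1} \<Longrightarrow> t' \<in> {0..1} \<Longrightarrow> \<bar>t' - t\<bar> < h \<Longrightarrow>
      norm (D (t', q) (0, v) - D (t, q) (0, v)) \<le> m / 2 * norm v"
    by blast
  have "norm ((transit s t q - q) - (transit s t q' - q')) \<le> norm (q - q') / 2"
    if s: "s \<in> {0..1}" and t: "t \<in> {0..1}" and d: "\<bar>t - s\<bar> < h" for s t q q'
  proof -
    have der: "((\<lambda>q. transit s t q - q) has_derivative (\<lambda>v. D (t, inv_flow s q) (0, DI s q v) - v)) (at q within UNIV)" for q
      unfolding transit_def
      by (intro has_derivative_diff has_derivative_compose[OF DI_deriv[OF s] D_space] has_derivative_ident)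
    have "norm ((transit s t q - q) - (transit s t q' - q')) \<le> 1 / 2 * norm (q - q')"
    proof (rule differentiable_bound[OF convex_UNIV der])
      fix q
      show "onorm (\<lambda>v. D (t, inv_flow s q) (0, DI s q v) - v) \<le> 1 / 2"
      proof (rule onorm_le)
        fix v
        have "m * norm (DI s q v) \<le> norm v"
          using m(2)[OF s, of "DI s q v" "inv_flow s q"] by (simp add: D_DI[OF s])
        then have "m / 2 * norm (DI s q v) \<le> 1 / 2 * norm v" by simp
        moreover have "norm (D (t, inv_flow s q) (0, DI s q v) - v) \<le> m / 2 * norm (DI s q v)"
          using h(2)[OF s t d, of "inv_flow s q" "DI s q v"] by (simp add: D_DI[OF s])
        ultimately show "norm (D (t, inv_flow s q) (0, DI s q v) - v) \<le> 1 / 2 * norm v" by linarith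
      qed
    qed auto
    then show ?thesis by simp
  qed
  then show ?thesis using h(1) unfolding short_step_def by (intro exI[of _ h]) auto
qed

lemma transit_deriv:
  assumes s: "s \<in> {0..1}"
  shows "((\<lambda>p. transit s (fst p) (snd p)) has_derivative
     (\<lambda>v. D (t, inv_flow s q) (fst v, DI s q (snd v)))) (at (t, q) within A)"
proof -
  have "((\<lambda>p. (fst p, inv_flow s (snd p))) has_derivative (\<lambda>v. (fst v, DI s q (snd v)))) (at (t, q) within A)"
  proof (intro has_derivative_Pair)
    have "(snd has_derivative snd) (at (t, q) within A)" by (auto intro!: derivative_eq_intros)
    moreover have "(inv_flow s has_derivative DI s q) (at (snd (t, q)))" using DI_deriv[OF s] by simp
    ultimately show "((\<lambda>p. inv_flow s (snd p)) has_derivative (\<lambda>v. DI s q (snd v))) (at (t, q) within A)"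
      by (rule has_derivative_compose)
  qed (auto intro!: derivative_eq_intros)
  from has_derivative_compose[OF this D_deriv] show ?thesis unfolding transit_def by simp
qed

text \<open>\<open>alpha_D\<close> at times \<open>s\<close> and \<open>t\<close>, applied to the
  same vector at \<open>inv_flow s q\<close>, yields the quotient of conformal factors in the
  spatial direction; the time direction gives the Hamiltonian.\<close>

lemma alpha_transit:
  assumes s: "s \<in> {0..1}" and t: "t \<in> {0..1}"
  shows "alpha (transit s t q) (D (t, inv_flow s q) (r, DI s q v)) = r * ham_at s t q + conf_factor s t q * alpha q v"
proof -
  have "alpha q v = E s (inv_flow s q) * alpha (inv_flow s q) (DI s q v)"
    using alpha_D[OF s, of "inv_flow s q" "DI s q v"] by (simp add: inv_flow_inverse[OF s] D_DI[OF s])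
  then have "alpha (transit s t q) (D (t, inv_flow s q) (0, DI s q v)) = conf_factor s t q * alpha q v"
    using alpha_D[OF t, of "inv_flow s q" "DI s q v"] E_pos[of s "inv_flow s q"] by (simp add: transit_def conf_factor_def)
  then show ?thesis
    by (subst D_split) (simp add: alpha_add alpha_scale ham_at_def)
qed

lemma ham_at_nonneg: "t \<in> {0..1} \<Longrightarrow> 0 \<le> ham_at s t q"
  unfolding ham_at_def transit_def by (rule hamiltonian_nonneg)

lemma conf_factor_pos: "0 < conf_factor s t q"
  unfolding conf_factor_def using E_pos by simp

lemma mixed_half:
  assumes "short_step s u" "t \<in> {s..u}"
  shows "norm ((mixed s t q - q) - (mixed s t q' - q')) \<le> norm (q - q') / 2"
proof -
  define w where "w = (transit s t q - q) - (transit s t q' - q')"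
  have "(mixed s t q - q) - (mixed s t q' - q') = (0, fst (snd w), 0)"
    by (simp add: mixed_def w_def prod_eq_iff)
  then have "norm ((mixed s t q - q) - (mixed s t q' - q')) = norm (fst (snd w))"
    by (simp add: norm_Pair)
  also have "\<dots> \<le> norm w"
    using norm_fst_le[of "fst (snd w)" "snd (snd w)"] norm_snd_le[of "snd w" "fst w"] by simp
  also have "\<dots> \<le> norm (q - q') / 2" using assms unfolding short_step_def w_def by blast
  finally show ?thesis .
qed

lemma mixed_expansive:
  "short_step s u \<Longrightarrow> t \<in> {s..u} \<Longrightarrow> norm (q - q') \<le> 2 * norm (mixed s t q - mixed s t q')"
  by (rule perturbed_identity_expansive) (rule mixed_half)

lemma mixed_inverse:
  assumes "short_step s u" "t \<in> {s..u}"
  shows "mixed s t (inv (mixed s t) p) = p" "inv (mixed s t) (mixed s t q) = q"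
proof -
  have "inj (mixed s t)"
  proof (rule injI)
    fix q q' assume "mixed s t q = mixed s t q'"
    then show "q = q'" using mixed_expansive[OF assms, of q q'] by simp
  qed
  moreover have "surj (mixed s t)"
    using perturbed_identity_surj[OF mixed_half[OF assms]] unfolding surj_def by metis
  ultimately show "mixed s t (inv (mixed s t) p) = p" "inv (mixed s t) (mixed s t q) = q"
    by (simp_all add: surj_f_inv_f)
qed

lemma continuous_mixed_inv:
  assumes "short_step s u" "t \<in> {s..u}"
  shows "continuous_on A (inv (mixed s t))"
proof -
  have "2-lipschitz_on UNIV (inv (mixed s t))"
    using mixed_expansive[OF assms, of "inv (mixed s t) p" "inv (mixed s t) p'" for p p']
    by (intro lipschitz_onI) (auto simp: dist_norm mixed_inverse[OF assms])
  then show ?thesis using lipschitz_on_continuous_on continuous_on_subset by blast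
qed

text \<open>The contact condition reads \<open>dZ - Y dX = H dt + e (dz - y dx)\<close>. Substituted
  into the differential of \<open>Z - z - Y (X - x)\<close>, it cancels \<open>dX\<close> and leaves
  \<open>lform\<close>; \<open>expansive_pushforward_derivative\<close> carries this over to mixed
  coordinates.\<close>

lemma gen_fun_deriv:
  assumes g: "short_step s u" and t: "t \<in> {s..u}"
  shows "((\<lambda>p. gen_fun s (fst p) (snd p)) has_derivative lform s t q) (at (t, mixed s t q) within {s..u} \<times> UNIV)"
proof -
  define S where "S = {s..u} \<times> (UNIV :: 'n pt set)"
  define F where "F = (\<lambda>p. gen_value s (fst p) (snd p))"
  define M where "M = (\<lambda>p. (fst p, mixed s (fst p) (snd p)))"
  have s01: "s \<in> {0..1}" and r01: "r \<in> {0..1}" if "r \<in> {s..u}" for r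
    using g that unfolding short_step_def by auto
  note s01 = s01[OF t]
  define W where "W v = D (t, inv_flow s q) (fst v, DI s q (snd v))" for v
  have W: "((\<lambda>p. transit s (fst p) (snd p)) has_derivative W) (at (t, q) within S)"
    unfolding W_def by (rule transit_deriv[OF s01])
  note W' = has_derivative_fst[OF W] has_derivative_snd[OF W] has_derivative_fst[OF has_derivative_snd[OF W]]
    has_derivative_snd[OF has_derivative_snd[OF W]]
  have M: "(M has_derivative (\<lambda>v. (fst v, fst (snd v), fst (snd (W v)), snd (snd (snd v))))) (at (t, q) within S)"
    unfolding M_def mixed_def
    by (intro has_derivative_Pair W' has_derivative_fst has_derivative_snd has_derivative_ident)
  have F: "(F has_derivative (\<lambda>v. snd (snd (W v)) - snd (snd (snd v))
      - (fst (snd (transit s t q)) \<bullet> (fst (W v) - fst (snd v)) + fst (snd (W v)) \<bullet> (fst (transit s t q) - fst q)))) (at (t, q) within S)"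
  proof -
    have D1: "((\<lambda>p. fst (snd p)) has_derivative (\<lambda>v. fst (snd v))) (at (t, q) within S)"
      and D2: "((\<lambda>p. snd (snd (snd p))) has_derivative (\<lambda>v. snd (snd (snd v)))) (at (t, q) within S)"
      by (intro has_derivative_fst has_derivative_snd has_derivative_ident)+
    show ?thesis
      unfolding F_def gen_value_def
      by (rule has_derivative_eq_rhs[OF has_derivative_diff[OF has_derivative_diff[OF W'(4) D2]
            has_derivative_inner[OF W'(3) has_derivative_diff[OF W'(1) D1]]]]) simp
  qed
  have "linear (lform s t q)"
    by (rule linearI) (simp_all add: lform_def inner_add_right algebra_simps)
  then have L: "bounded_linear (lform s t q)" by (rule linear_conv_bounded_linear[THEN iffD1])
  have FL: "snd (snd (W v)) - snd (snd (snd v))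
      - (fst (snd (transit s t q)) \<bullet> (fst (W v) - fst (snd v)) + fst (snd (W v)) \<bullet> (fst (transit s t q) - fst q)) =
      lform s t q (fst v, fst (snd v), fst (snd (W v)), snd (snd (snd v)))" for v
  proof -
    have "snd (snd (W v)) - fst (snd (transit s t q)) \<bullet> fst (W v) =
        fst v * ham_at s t q + conf_factor s t q * (snd (snd (snd v)) - fst (snd q) \<bullet> fst (snd v))"
      using alpha_transit[OF s01 r01[OF t], of q "fst v" "snd v"] unfolding W_def alpha_def .
    then show ?thesis
      unfolding lform_def fst_conv snd_conv inner_diff_right[of "fst (snd (transit s t q))"]
        inner_commute[of "fst (snd (W v))"] by linarith
  qed
  obtain B where B: "0 \<le> B" "\<And>r t q. r \<in> {0..1} \<Longrightarrow> t \<in> {0..1} \<Longrightarrow> norm (\<Phi> (r, q) - \<Phi> (t, q)) \<le> B * \<bar>r - t\<bar>"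
    using time_lipschitz by blast
  \<comment> \<open>Times differ by at most \<open>d\<close>, and changing the time moves
    \<open>mixed\<close> by at most \<open>B * d\<close>, so \<open>q' - q\<close> is at most
    \<open>2 * (d + B * d)\<close>; adding up gives the factor \<open>3 + 2 * B\<close>.\<close>
  have exp: "norm (y - (t, q)) \<le> (3 + 2 * B) * norm (M y - M (t, q))" if y: "y \<in> S" for y
  proof -
    obtain t' q' where y': "y = (t', q')" by (cases y)
    have t': "t' \<in> {s..u}" using y by (simp add: S_def y')
    define d where "d = norm (M y - M (t, q))"
    have d1: "\<bar>t' - t\<bar> \<le> d"
      using norm_fst_le[of "t' - t" "mixed s t' q' - mixed s t q"] by (simp add: d_def M_def y')
    have d2: "norm (mixed s t' q' - mixed s t q) \<le> d"
      using norm_snd_le[of "mixed s t' q' - mixed s t q" "t' - t"] by (simp add: d_def M_def y')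
    have "norm (mixed s t' q' - mixed s t q') = norm (fst (snd (transit s t' q' - transit s t q')))"
      by (simp add: mixed_def norm_Pair)
    also have "\<dots> \<le> norm (transit s t' q' - transit s t q')"
      using norm_fst_le[of "fst (snd (transit s t' q' - transit s t q'))" "snd (snd (transit s t' q' - transit s t q'))"]
        norm_snd_le[of "snd (transit s t' q' - transit s t q')" "fst (transit s t' q' - transit s t q')"]
      unfolding prod.collapse by (rule order_trans)
    also have "\<dots> \<le> B * \<bar>t' - t\<bar>"
      unfolding transit_def by (rule B(2)[OF r01[OF t'] r01[OF t]])
    also have "\<dots> \<le> B * d" using d1 B by (intro mult_left_mono) auto
    finally have d3: "norm (mixed s t' q' - mixed s t q') \<le> B * d" .
    have "norm (mixed s t q' - mixed s t q) \<le> norm (mixed s t' q' - mixed s t q) + norm (mixed s t' q' - mixed s t q')"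
      using norm_triangle_ineq4[of "mixed s t' q' - mixed s t q" "mixed s t' q' - mixed s t q'"] by simp
    also have "\<dots> \<le> d + B * d" using d2 d3 by (rule add_mono)
    finally have "2 * norm (mixed s t q' - mixed s t q) \<le> 2 * (d + B * d)" by (rule mult_left_mono) simp
    with mixed_expansive[OF g t, of q' q] have "norm (q' - q) \<le> 2 * (d + B * d)" by (rule order_trans)
    moreover have "norm (y - (t, q)) \<le> \<bar>t' - t\<bar> + norm (q' - q)"
      using norm_Pair_le[of "t' - t" "q' - q"] by (simp add: y')
    ultimately show ?thesis using d1 unfolding d_def[symmetric] by (simp add: algebra_simps)
  qed
  have f: "gen_fun s (fst (M y)) (snd (M y)) = F y" if "y \<in> S" for y
    using that unfolding F_def M_def gen_fun_def S_def by (auto simp: mixed_inverse[OF g])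
  have MS: "M ` S = S"
  proof
    show "S \<subseteq> M ` S"
    proof
      fix w assume w: "w \<in> S"
      then have "fst w \<in> {s..u}" unfolding S_def by auto
      then have "w = M (fst w, inv (mixed s (fst w)) (snd w))" "(fst w, inv (mixed s (fst w)) (snd w)) \<in> S"
        unfolding M_def S_def by (simp_all add: mixed_inverse[OF g])
      then show "w \<in> M ` S" by (rule image_eqI)
    qed
  qed (auto simp: M_def S_def)
  have tS: "(t, q) \<in> S" using t by (simp add: S_def)
  have "((\<lambda>p. gen_fun s (fst p) (snd p)) has_derivative lform s t q) (at (M (t, q)) within M ` S)"
    by (rule expansive_pushforward_derivative[OF F M L FL tS exp f])
  then show ?thesis unfolding MS unfolding M_def S_def by simp
qed

lemma gen_fun_space_deriv:
  assumes g: "short_step s u"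
  shows "(gen_fun s u has_derivative (\<lambda>v. lform s u (inv (mixed s u) p) (0, v))) (at p)"
proof -
  have u: "u \<in> {s..u}" using g by (simp add: short_step_def)
  have 1: "((\<lambda>p. (u, p)) has_derivative (\<lambda>v. (0, v))) (at p)"
    by (auto intro!: derivative_eq_intros)
  have 2: "((\<lambda>p. gen_fun s (fst p) (snd p)) has_derivative lform s u (inv (mixed s u) p)) (at (u, p) within range (Pair u))"
    by (rule has_derivative_subset[OF gen_fun_deriv[OF g u, of "inv (mixed s u) p", unfolded mixed_inverse[OF g u]]]) (use u in auto)
  from has_derivative_in_compose[OF 1 2] show ?thesis by simp
qed

lemma gen_fun_start:
  assumes g: "short_step s u"
  shows "gen_fun s s p = 0"
proof -
  have s: "s \<in> {s..u}" "s \<in> {0..1}" using g by (auto simp: short_step_def)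
  have "transit s s q = q" for q unfolding transit_def by (rule inv_flow_inverse[OF s(2)])
  then show ?thesis by (simp add: gen_fun_def gen_value_def)
qed

text \<open>The generating function starts at 0, and at a fixed mixed point its time derivative is
  the nonnegative Hamiltonian.\<close>

lemma gen_fun_nonneg:
  assumes g: "short_step s u"
  shows "0 \<le> gen_fun s u p"
proof -
  have su: "s \<le> u" using g by (simp add: short_step_def)
  have der: "((\<lambda>t. gen_fun s t p) has_derivative (\<lambda>r. r * ham_at s t (inv (mixed s t) p))) (at t within {s..u})"
    if "s \<le> t" "t \<le> u" for t
  proof -
    have t: "t \<in> {s..u}" using that by simp
    have 1: "((\<lambda>t. (t, p)) has_derivative (\<lambda>r. (r, 0))) (at t within {s..u})"
      by (auto intro!: derivative_eq_intros)
    have 2: "((\<lambda>p. gen_fun s (fst p) (snd p)) has_derivative lform s t (inv (mixed s t) p)) (at (t, p) within (\<lambda>t. (t, p)) ` {s..u})"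
      by (rule has_derivative_subset[OF gen_fun_deriv[OF g t, of "inv (mixed s t) p", unfolded mixed_inverse[OF g t]]]) auto
    from has_derivative_in_compose[OF 1 2] show ?thesis by (simp add: lform_def)
  qed
  obtain t where t: "t \<in> {s..u}" "gen_fun s u p - gen_fun s s p = (u - s) * ham_at s t (inv (mixed s t) p)"
    using mvt_very_simple[OF su der] by blast
  have "0 \<le> ham_at s t (inv (mixed s t) p)"
    using t g by (intro ham_at_nonneg) (auto simp: short_step_def)
  then show ?thesis using t su gen_fun_start[OF g] by simp
qed

text \<open>The last clause recovers the map from its generating function. Its premise is the
  relation \<open>a = Y - e y\<close>, the form in which \<open>critical_orbit\<close> links
  consecutive momenta.\<close>

definition generates where
  "generates s u f a b c \<longleftrightarrow>
     (\<forall>p. (f has_derivative (\<lambda>v. a p \<bullet> fst v + b p \<bullet> fst (snd v) + c p * snd (snd v))) (at p)) \<and>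
     continuous_on UNIV a \<and> continuous_on UNIV b \<and> continuous_on UNIV c \<and>
     (\<forall>p. p \<notin> K \<longrightarrow> f p = 0) \<and> (\<forall>p. 0 \<le> f p) \<and> (\<forall>p. 0 < 1 + c p) \<and>
     (\<forall>x y Y z. (1 + c (x, Y, z)) *\<^sub>R y = Y - a (x, Y, z) \<longrightarrow>
        transit s u (x, y, z) = (x - b (x, Y, z), Y, z - Y \<bullet> b (x, Y, z) + f (x, Y, z)) \<and>
        1 + c (x, Y, z) = conf_factor s u (x, y, z))"

text \<open>\<open>a\<close>, \<open>b\<close>, \<open>c\<close> are read off from
  \<open>lform\<close> through the inverse of \<open>mixed\<close>. Since the conformal factor is
  positive, the relation for \<open>a\<close> determines \<open>y\<close> and hence the source point
  of the mixed point.\<close>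

lemma generating_function:
  assumes g: "short_step s u"
  shows "\<exists>f a b c. generates s u f a b c"
proof -
  have u: "u \<in> {s..u}" and s01: "s \<in> {0..1}" and u01: "u \<in> {0..1}" using g by (auto simp: short_step_def)
  define th where "th = inv (mixed s u)"
  have mixed_th: "mixed s u (th p) = p" "th (mixed s u q) = q" for p q
    unfolding th_def by (rule mixed_inverse[OF g u])+
  have th: "fst (th p) = fst p" "fst (snd (transit s u (th p))) = fst (snd p)" "snd (snd (th p)) = snd (snd p)" for p
    using mixed_th(1)[of p] by (auto simp: mixed_def prod_eq_iff)
  define a where "a p = fst (snd p) - conf_factor s u (th p) *\<^sub>R fst (snd (th p))" for p
  define b where "b p = - (fst (transit s u (th p)) - fst p)" for p
  define c where "c p = conf_factor s u (th p) - 1" for p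
  have cth: "continuous_on UNIV th" unfolding th_def by (rule continuous_mixed_inv[OF g u])
  have cip: "continuous_on UNIV (inv_flow s)" by (intro smooth_continuous_on inv_flow_smooth s01)
  have cE: "continuous_on UNIV (\<lambda>p. E t (inv_flow s (th p)))" if "t \<in> {0..1}" for t
    by (rule continuous_on_compose2[OF continuous_E[OF that] continuous_on_compose2[OF cip cth]]) auto
  have nz: "E s q \<noteq> 0" for q using E_pos[of s q] by simp
  have cfac: "continuous_on UNIV (\<lambda>p. conf_factor s u (th p))"
    unfolding conf_factor_def by (intro continuous_intros cE s01 u01) (simp add: nz)
  have cps: "continuous_on UNIV (\<lambda>p. transit s u (th p))"
    unfolding transit_def
    by (rule continuous_on_compose2[OF smooth_continuous_on[OF smooth, of UNIV]])
       (auto intro!: continuous_intros continuous_on_compose2[OF cip cth])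
  have "continuous_on UNIV a" "continuous_on UNIV b" "continuous_on UNIV c"
    unfolding a_def b_def c_def by (intro continuous_intros cfac cth cps)+
  moreover have "(gen_fun s u has_derivative (\<lambda>v. a p \<bullet> fst v + b p \<bullet> fst (snd v) + c p * snd (snd v))) (at p)" for p
  proof (rule has_derivative_eq_rhs[OF gen_fun_space_deriv[OF g]])
    show "(\<lambda>v. lform s u (inv (mixed s u) p) (0, v)) = (\<lambda>v. a p \<bullet> fst v + b p \<bullet> fst (snd v) + c p * snd (snd v))"
      unfolding th_def[symmetric]
      by (rule ext) (simp add: lform_def a_def b_def c_def th inner_diff_left algebra_simps)
  qed
  moreover have "gen_fun s u p = 0" if "p \<notin> K" for p
  proof -
    have transit: "transit s u p = p" unfolding transit_def inv_flow_off[OF s01 that] by (rule off_K[OF u01 that])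
    then have "mixed s u p = p" by (simp add: mixed_def)
    then have "th p = p" using mixed_th(2)[of p] by simp
    then show ?thesis unfolding gen_fun_def th_def[symmetric] by (simp add: gen_value_def transit)
  qed
  moreover have "0 \<le> gen_fun s u p" for p by (rule gen_fun_nonneg[OF g])
  moreover have "0 < 1 + c p" for p unfolding c_def using conf_factor_pos by simp
  moreover have "transit s u (x, y, z) = (x - b (x, Y, z), Y, z - Y \<bullet> b (x, Y, z) + gen_fun s u (x, Y, z)) \<and>
        1 + c (x, Y, z) = conf_factor s u (x, y, z)"
    if eq: "(1 + c (x, Y, z)) *\<^sub>R y = Y - a (x, Y, z)" for x y Y z
  proof -
    let ?p = "(x, Y, z)"
    have "conf_factor s u (th ?p) *\<^sub>R y = conf_factor s u (th ?p) *\<^sub>R fst (snd (th ?p))"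
      using eq by (simp add: a_def c_def)
    then have "y = fst (snd (th ?p))" using conf_factor_pos[of s u "th ?p"] by simp
    then have q: "(x, y, z) = th ?p" using th[of ?p] by (simp add: prod_eq_iff)
    have "gen_fun s u ?p = snd (snd (transit s u (th ?p))) - z - Y \<bullet> (fst (transit s u (th ?p)) - x)"
      unfolding gen_fun_def th_def[symmetric] gen_value_def using th[of ?p] by simp
    then show ?thesis
      unfolding q using th[of ?p] by (auto simp: prod_eq_iff b_def c_def inner_diff_right)
  qed
  ultimately have "generates s u (gen_fun s u) a b c"
    unfolding generates_def by blast
  then show ?thesis by blast
qed

end

section \<open>Iterated translated points\<close>

text \<open>By the chain rule conformal exponents add up along an orbit; differentiability is
  carried through the induction to make the chain rule available.\<close>

lemma pullback_iterate:
  assumes "contactomorphism \<phi>"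
  shows "pullback_factor (\<phi> ^^ k) (\<lambda>q. \<Sum>m<k. gfun \<phi> ((\<phi> ^^ m) q)) \<and> (\<forall>q. (\<phi> ^^ k) differentiable (at q))"
proof (induction k)
  case 0
  have "frechet_derivative (\<lambda>x. x) (at q) = (\<lambda>v. v)" for q :: "'a pt"
    by (rule frechet_derivative_ident)
  then show ?case by (simp add: pullback_factor_def id_def)
next
  case (Suc k)
  have sm: "smooth \<phi>" using assms by (simp add: contactomorphism_def)
  have der: "((\<phi> ^^ Suc k) has_derivative (\<lambda>v. frechet_derivative \<phi> (at ((\<phi> ^^ k) q))
      (frechet_derivative (\<phi> ^^ k) (at q) v))) (at q)" for q
  proof -
    have "((\<phi> ^^ k) has_derivative frechet_derivative (\<phi> ^^ k) (at q)) (at q)"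
      using Suc frechet_derivative_works by blast
    from has_derivative_compose[OF this smooth_has_derivative[OF sm]] show ?thesis
      by (simp add: o_def)
  qed
  have "alpha ((\<phi> ^^ Suc k) q) (frechet_derivative (\<phi> ^^ Suc k) (at q) v) =
      exp (\<Sum>m<Suc k. gfun \<phi> ((\<phi> ^^ m) q)) * alpha q v" for q v
  proof -
    have 1: "alpha ((\<phi> ^^ k) q) (frechet_derivative (\<phi> ^^ k) (at q) v) =
        exp (\<Sum>m<k. gfun \<phi> ((\<phi> ^^ m) q)) * alpha q v" for q v
      using Suc unfolding pullback_factor_def by blast
    have 2: "alpha (\<phi> q) (frechet_derivative \<phi> (at q) v) = exp (gfun \<phi> q) * alpha q v" for q v
      using pullback_gfun[OF assms] unfolding pullback_factor_def by blast
    show ?thesis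
      unfolding frechet_derivative_at[OF der, symmetric] by (simp add: 1 2 exp_add)
  qed
  moreover have "\<forall>q. (\<phi> ^^ Suc k) differentiable (at q)"
    using der unfolding differentiable_def by blast
  ultimately show ?case unfolding pullback_factor_def by blast
qed

lemma gfun_iterate:
  assumes "contactomorphism \<phi>"
  shows "gfun (\<phi> ^^ k) q = (\<Sum>m<k. gfun \<phi> ((\<phi> ^^ m) q))"
  by (rule fun_cong[OF gfun_eq[OF conjunct1[OF pullback_iterate[OF assms]]]])

context isotopy
begin

text \<open>\<open>[0, 1]\<close> is cut into \<open>n\<close> short steps and these are run
  \<open>k\<close> times. A critical orbit of the resulting chain with \<open>k * n\<close> corners
  closes up in x and y, gains height, and has total conformal factor 1.\<close>

lemma iterate_has_translated_point:
  assumes ne: "(\<lambda>q. \<Phi> (1, q)) \<noteq> id" and k: "1 \<le> k"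
  defines "\<phi> \<equiv> (\<lambda>q. \<Phi> (1, q))"
  shows "\<exists>q r. 0 < r \<and> (\<phi> ^^ k) q = (fst q, fst (snd q), snd (snd q) + r) \<and>
     (\<Sum>m<k. gfun \<phi> ((\<phi> ^^ m) q)) = 0"
proof -
  obtain h where h: "0 < h" "\<And>s u. s \<in> {0..1} \<Longrightarrow> u \<in> {0..1} \<Longrightarrow> s \<le> u \<Longrightarrow> u - s < h \<Longrightarrow> short_step s u"
    using small_steps by blast
  obtain n where n: "1 / h < real n" using reals_Archimedean2 by blast
  have "0 < 1 / h" using h by simp
  then have n0: "0 < n" using n by (metis of_nat_0_less_iff order.strict_trans)
  define \<tau> where "\<tau> i = real i / real n" for i
  have tau: "\<tau> i \<in> {0..1}" if "i \<le> n" for i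
    using that n0 by (simp add: \<tau>_def)
  have tau0: "\<tau> 0 = 0" and taun: "\<tau> n = 1" using n0 by (auto simp: \<tau>_def)
  have short_step: "short_step (\<tau> i) (\<tau> (Suc i))" if "i < n" for i
  proof (rule h(2))
    show "\<tau> (Suc i) - \<tau> i < h"
      using n n0 h(1) by (simp add: \<tau>_def field_simps)
  qed (use tau[of i] tau[of "Suc i"] that in \<open>auto simp: \<tau>_def divide_right_mono\<close>)
  have ex: "\<exists>f a b c. i < n \<longrightarrow> generates (\<tau> i) (\<tau> (Suc i)) f a b c" for i
    using generating_function[OF short_step] by blast
  obtain f a b c where gen: "\<And>i. i < n \<Longrightarrow> generates (\<tau> i) (\<tau> (Suc i)) (f i) (a i) (b i) (c i)"
    using ex by metis
  \<comment> \<open>If all generating functions vanished, so would their derivatives; every short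
    step, and with them the time-1 map, would be the identity.\<close>
  have "\<exists>i<n. \<exists>p. f i p \<noteq> 0"
  proof (rule ccontr)
    assume no: "\<not> (\<exists>i<n. \<exists>p. f i p \<noteq> 0)"
    have step: "transit (\<tau> i) (\<tau> (Suc i)) q = q" if i: "i < n" for i q
    proof -
      obtain x y z where q: "q = (x, y, z)" by (cases q)
      have f0: "f i = (\<lambda>p. 0)" using no i by blast
      let ?p = "(x, y, z)"
      have "(f i has_derivative (\<lambda>v. a i ?p \<bullet> fst v + b i ?p \<bullet> fst (snd v) + c i ?p * snd (snd v))) (at ?p)"
        using gen[OF i] by (simp add: generates_def)
      then have eq: "(\<lambda>v. a i ?p \<bullet> fst v + b i ?p \<bullet> fst (snd v) + c i ?p * snd (snd v)) = (\<lambda>v. 0)"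
        unfolding f0 by (rule has_derivative_unique) simp
      have "a i ?p = 0" "b i ?p = 0" "c i ?p = 0"
        using fun_cong[OF eq, of "(a i ?p, 0, 0)"] fun_cong[OF eq, of "(0, b i ?p, 0)"]
          fun_cong[OF eq, of "(0, 0, 1)"] by auto
      moreover have "(1 + c i ?p) *\<^sub>R y = y - a i ?p \<longrightarrow>
          transit (\<tau> i) (\<tau> (Suc i)) (x, y, z) = (x - b i ?p, y, z - y \<bullet> b i ?p + f i ?p)"
        using gen[OF i] unfolding generates_def by blast
      ultimately show ?thesis using f0 q by simp
    qed
    have "\<Phi> (\<tau> i, q) = q" if "i \<le> n" for i q
      using that
    proof (induction i)
      case 0
      then show ?case by (simp add: tau0 at_0)
    next
      case (Suc i)
      then have "inv_flow (\<tau> i) q = q" using inv_flow_inverse(2)[OF tau, of i q] by simp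
      then show ?case using step[of i q] Suc by (simp add: transit_def)
    qed
    from this[of n] show False using ne by (auto simp: taun id_def)
  qed
  then obtain i0 p0 where i0: "i0 < n" "f i0 p0 \<noteq> 0" by blast
  have i0N: "i0 < k * n" using i0 k by (metis less_le_trans mult.commute mult_le_mono2 mult_1_right)
  have gen': "generates (\<tau> (j mod n)) (\<tau> (Suc (j mod n))) (f (j mod n)) (a (j mod n)) (b (j mod n)) (c (j mod n))" for j
    using gen n0 by simp
  interpret chain "\<lambda>j. f (j mod n)" "\<lambda>j. c (j mod n)" "\<lambda>j. a (j mod n)" "\<lambda>j. b (j mod n)" "k * n" K
  proof
    show "0 < k * n" using k n0 by simp
    show "\<exists>j<k * n. \<exists>p. f (j mod n) p \<noteq> 0"
      using i0 i0N by (intro exI[of _ i0] conjI exI[of _ p0]) simp_all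
  qed (use gen'[unfolded generates_def] compact_K in blast)+
  obtain x y z where end_x: "x (k * n) = x 0" and end_y: "y (k * n) = y 0" and end_z: "z 0 < z (k * n)"
    and prod1: "(\<Prod>j<k * n. 1 + c (j mod n) (x j, y (Suc j), z j)) = 1"
    and steps: "\<And>j. j < k * n \<Longrightarrow> x (Suc j) = x j - b (j mod n) (x j, y (Suc j), z j)
       \<and> (1 + c (j mod n) (x j, y (Suc j), z j)) *\<^sub>R y j = y (Suc j) - a (j mod n) (x j, y (Suc j), z j)
       \<and> z (Suc j) = z j + y (Suc j) \<bullet> (x (Suc j) - x j) + f (j mod n) (x j, y (Suc j), z j)"
    using critical_orbit by blast
  define q where "q j = (x j, y j, z j)" for j
  define C where "C j = 1 + c (j mod n) (x j, y (Suc j), z j)" for j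
  have orbit: "transit (\<tau> (j mod n)) (\<tau> (Suc (j mod n))) (q j) = q (Suc j)"
    "C j = conf_factor (\<tau> (j mod n)) (\<tau> (Suc (j mod n))) (q j)" if j: "j < k * n" for j
  proof -
    let ?p = "(x j, y (Suc j), z j)"
    have "(1 + c (j mod n) ?p) *\<^sub>R y j = y (Suc j) - a (j mod n) ?p \<longrightarrow>
        transit (\<tau> (j mod n)) (\<tau> (Suc (j mod n))) (q j) =
          (x j - b (j mod n) ?p, y (Suc j), z j - y (Suc j) \<bullet> b (j mod n) ?p + f (j mod n) ?p) \<and>
        1 + c (j mod n) ?p = conf_factor (\<tau> (j mod n)) (\<tau> (Suc (j mod n))) (q j)"
      using gen'[of j] unfolding generates_def q_def by blast
    then show "transit (\<tau> (j mod n)) (\<tau> (Suc (j mod n))) (q j) = q (Suc j)"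
      "C j = conf_factor (\<tau> (j mod n)) (\<tau> (Suc (j mod n))) (q j)"
      using steps[OF j] by (auto simp: q_def C_def)
  qed
  \<comment> \<open>Within the \<open>m\<close>-th period the corners follow the isotopy from
    \<open>q (m * n)\<close>, and the conformal factors, being quotients of consecutive values of
    \<open>E\<close>, telescope.\<close>
  have block: "q (m * n + i) = \<Phi> (\<tau> i, q (m * n)) \<and>
      (\<Prod>j<m * n + i. C j) = (\<Prod>j<m * n. C j) * E (\<tau> i) (q (m * n))"
    if m: "m < k" and "i \<le> n" for m i
    using that(2)
  proof (induction i)
    case 0
    then show ?case by (simp add: tau0 at_0 E_0)
  next
    case (Suc i)
    have "m * n + i < Suc m * n" using Suc.prems by simp
    also have "\<dots> \<le> k * n" using m by (intro mult_right_mono) auto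
    finally have j: "m * n + i < k * n" .
    have mod: "(m * n + i) mod n = i" using Suc.prems by simp
    have ti: "\<tau> i \<in> {0..1}" using Suc.prems by (intro tau) auto
    have q: "q (m * n + i) = \<Phi> (\<tau> i, q (m * n))" using Suc by simp
    have "q (m * n + Suc i) = \<Phi> (\<tau> (Suc i), q (m * n))"
      using orbit(1)[OF j] unfolding mod q transit_def inv_flow_inverse[OF ti] by simp
    moreover have "C (m * n + i) = E (\<tau> (Suc i)) (q (m * n)) / E (\<tau> i) (q (m * n))"
      using orbit(2)[OF j] unfolding mod q conf_factor_def inv_flow_inverse[OF ti] .
    ultimately show ?case using Suc E_pos[of "\<tau> i" "q (m * n)"] by simp
  qed
  have iter: "q (m * n) = (\<phi> ^^ m) (q 0) \<and> (\<Prod>j<m * n. C j) = exp (\<Sum>l<m. gfun \<phi> ((\<phi> ^^ l) (q 0)))"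
    if "m \<le> k" for m
    using that
  proof (induction m)
    case (Suc m)
    then show ?case
      using block[of m n] by (simp add: taun \<phi>_def E_def exp_add add.commute)
  qed simp
  have "exp (\<Sum>l<k. gfun \<phi> ((\<phi> ^^ l) (q 0))) = 1"
    using iter[of k] prod1 by (simp add: C_def)
  then have "(\<Sum>l<k. gfun \<phi> ((\<phi> ^^ l) (q 0))) = 0" by simp
  moreover have "(\<phi> ^^ k) (q 0) = (x 0, y 0, z (k * n))"
    using iter[of k] end_x end_y by (simp add: q_def)
  ultimately show ?thesis
    using end_z by (intro exI[of _ "q 0"] exI[of _ "z (k * n) - z 0"]) (simp add: q_def)
qed

end

section \<open>From all iterates to infinitely many points\<close>

definition nontrivial_translated :: "('n::finite pt \<Rightarrow> 'n pt) \<Rightarrow> nat \<Rightarrow> 'n pt \<Rightarrow> bool" where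
  "nontrivial_translated \<phi> k q \<longleftrightarrow> 1 \<le> k \<and> translated_point (\<phi> ^^ k) q \<and> contact_action (\<phi> ^^ k) q \<noteq> 0"

text \<open>Both images lie on the Reeb line of \<open>q\<close>, so the later iterate arises from
  the earlier one by a translation along it. Additivity of the conformal exponents makes the
  remaining exponent 0, and distinctness makes the action nonzero.\<close>

lemma translated_difference:
  assumes \<phi>: "contactomorphism \<phi>" and k: "translated_point (\<phi> ^^ k) q" and l: "translated_point (\<phi> ^^ l) q"
    and "k < l" and ne: "(\<phi> ^^ k) q \<noteq> (\<phi> ^^ l) q"
  shows "nontrivial_translated \<phi> (l - k) ((\<phi> ^^ k) q)"
proof -
  have comp: "(\<phi> ^^ j) ((\<phi> ^^ k) q) = (\<phi> ^^ (k + j)) q" for j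
    by (simp add: funpow_add add.commute[of k])
  have kl: "k + (l - k) = l" using \<open>k < l\<close> by simp
  have "(\<Sum>m<k + j. gfun \<phi> ((\<phi> ^^ m) q)) =
      (\<Sum>m<k. gfun \<phi> ((\<phi> ^^ m) q)) + (\<Sum>m<j. gfun \<phi> ((\<phi> ^^ m) ((\<phi> ^^ k) q)))" for j
    by (induction j) (simp_all add: comp)
  from this[of "l - k"] have "gfun (\<phi> ^^ (l - k)) ((\<phi> ^^ k) q) = 0"
    using k l unfolding translated_point_def gfun_iterate[OF \<phi>] kl by simp
  then show ?thesis
    using k l ne \<open>k < l\<close>
    unfolding nontrivial_translated_def translated_point_def contact_action_def comp kl
    by (auto simp: prod_eq_iff)
qed

text \<open>For a point that is not periodic, the images under its infinitely many exponents are
  distinct. Each is a non-trivial translated point of some iterate, by comparison with a larger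
  exponent, against finiteness.\<close>

lemma periodic_of_infinite:
  assumes \<phi>: "contactomorphism \<phi>" and fin: "finite {q. \<exists>k. nontrivial_translated \<phi> k q}"
    and inf: "infinite {k. nontrivial_translated \<phi> k q}"
  shows "\<exists>m\<ge>1. (\<phi> ^^ m) q = q"
proof (rule ccontr)
  assume no: "\<not> (\<exists>m\<ge>1. (\<phi> ^^ m) q = q)"
  have inj: "inj (\<phi> ^^ k)" for k
    using \<phi> by (intro inj_fn) (simp add: contactomorphism_def bij_is_inj)
  have ne: "(\<phi> ^^ k) q \<noteq> (\<phi> ^^ l) q" if "k < l" for k l
  proof
    assume "(\<phi> ^^ k) q = (\<phi> ^^ l) q"
    also have "(\<phi> ^^ l) q = (\<phi> ^^ k) ((\<phi> ^^ (l - k)) q)"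
      using that funpow_add[of k "l - k" \<phi>] by simp
    finally have "(\<phi> ^^ (l - k)) q = q" using inj[of k] by (simp add: inj_eq)
    moreover have "1 \<le> l - k" using that by simp
    ultimately show False using no by blast
  qed
  let ?A = "{k. nontrivial_translated \<phi> k q}"
  have "(\<lambda>k. (\<phi> ^^ k) q) ` ?A \<subseteq> {q. \<exists>k. nontrivial_translated \<phi> k q}"
  proof
    fix p assume "p \<in> (\<lambda>k. (\<phi> ^^ k) q) ` ?A"
    then obtain k where k: "nontrivial_translated \<phi> k q" "p = (\<phi> ^^ k) q" by blast
    obtain l where l: "k < l" "nontrivial_translated \<phi> l q"
      using inf unfolding infinite_nat_iff_unbounded by blast
    show "p \<in> {q. \<exists>k. nontrivial_translated \<phi> k q}"
      using translated_difference[OF \<phi> _ _ l(1) ne[OF l(1)]] k l unfolding nontrivial_translated_def by blast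
  qed
  then have "finite ((\<lambda>k. (\<phi> ^^ k) q) ` ?A)" using fin finite_subset by blast
  moreover have "inj_on (\<lambda>k. (\<phi> ^^ k) q) ?A"
    by (rule linorder_inj_onI') (use ne in auto)
  ultimately show False using inf finite_imageD by blast
qed

text \<open>Suppose there are finitely many points. Those with infinitely many exponents form
  \<open>T\<close> and are periodic; the exponents of the others form a finite set \<open>B\<close>.
  An exponent outside \<open>B\<close> divisible by all periods admits no point.\<close>

lemma infinitely_many_of_each:
  assumes \<phi>: "contactomorphism \<phi>" and ex: "\<And>k. 1 \<le> k \<Longrightarrow> \<exists>q. nontrivial_translated \<phi> k q"
  shows "infinite {q. \<exists>k. nontrivial_translated \<phi> k q}"
proof
  let ?S = "{q. \<exists>k. nontrivial_translated \<phi> k q}"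
  let ?A = "\<lambda>q. {k. nontrivial_translated \<phi> k q}"
  assume fin: "finite ?S"
  define T where "T = {q. infinite (?A q)}"
  have TS: "T \<subseteq> ?S"
  proof
    fix q assume "q \<in> T"
    then have "?A q \<noteq> {}" unfolding T_def by force
    then show "q \<in> ?S" by blast
  qed
  then have finT: "finite T" using fin by (rule finite_subset)
  have "\<exists>m. 1 \<le> m \<and> (\<phi> ^^ m) q = q" if "q \<in> T" for q
    using periodic_of_infinite[OF \<phi> fin, of q] that unfolding T_def by simp
  then obtain per where per: "\<And>q. q \<in> T \<Longrightarrow> 1 \<le> per q" "\<And>q. q \<in> T \<Longrightarrow> (\<phi> ^^ per q) q = q"
    by metis
  define B where "B = (\<Union>q\<in>?S - T. ?A q)"
  have "finite B"
    unfolding B_def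
  proof (rule finite_UN_I)
    show "finite (?S - T)" using fin by (rule finite_Diff)
    show "finite (?A q)" if "q \<in> ?S - T" for q using that by (simp add: T_def)
  qed
  then obtain b where b: "\<And>k. k \<in> B \<Longrightarrow> k \<le> b"
    unfolding finite_nat_set_iff_bounded_le by auto
  \<comment> \<open>The product is a multiple of every period, and the factor \<open>Suc b\<close>
    takes it beyond all elements of \<open>B\<close>.\<close>
  define k where "k = (\<Prod>q\<in>T. per q) * Suc b"
  have "1 \<le> (\<Prod>q\<in>T. per q)" by (rule prod_ge_1) (rule per(1))
  then have "Suc b \<le> k" unfolding k_def using mult_le_mono1[of 1 _ "Suc b"] by simp
  then have kb: "b < k" "1 \<le> k" by auto
  obtain q where q: "nontrivial_translated \<phi> k q" using ex[OF kb(2)] by blast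
  have "q \<in> T"
  proof (rule ccontr)
    assume "q \<notin> T"
    then have "q \<in> ?S - T" using q by blast
    moreover have "k \<in> ?A q" using q by simp
    ultimately have "k \<in> B" unfolding B_def by (rule UN_I)
    then show False using b[of k] kb by simp
  qed
  have "per q dvd (\<Prod>q\<in>T. per q)" by (rule dvd_prodI[OF finT \<open>q \<in> T\<close>])
  then have "per q dvd k" unfolding k_def by (rule dvd_mult2)
  then obtain r where r: "k = per q * r" by (rule dvdE)
  have "((\<phi> ^^ per q) ^^ r) q = q" using per(2)[OF \<open>q \<in> T\<close>] by (induction r) simp_all
  then have "(\<phi> ^^ k) q = q" unfolding r by (simp add: funpow_mult)
  then show False using q by (simp add: nontrivial_translated_def contact_action_def)
qed

theorem theorem3p1:
  fixes \<phi> :: "'n::finite pt \<Rightarrow> 'n pt"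
  assumes "contactomorphism \<phi>"
    and "compactly_supported \<phi>"
    and "positive_contactomorphism \<phi>"
  shows "infinite {q. \<exists>k::nat. k \<ge> 1 \<and> translated_point (\<phi> ^^ k) q
                              \<and> contact_action (\<phi> ^^ k) q \<noteq> 0}"
proof -
  obtain \<Phi> where ne: "\<phi> \<noteq> id" and iso: "contact_isotopy \<Phi>" and end1: "\<And>q. \<Phi> (1, q) = \<phi> q"
    and pos: "\<forall>t\<in>{0..1}. \<forall>p \<in> interior (closure {p. contact_hamiltonian \<Phi> t p \<noteq> 0}). contact_hamiltonian \<Phi> t p > 0"
    using assms(3) unfolding positive_contactomorphism_def by blast
  obtain K where K: "compact K" "\<forall>t\<in>{0..1}. \<forall>q. q \<notin> K \<longrightarrow> \<Phi> (t, q) = q"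
    using iso unfolding contact_isotopy_def by blast
  interpret isotopy \<Phi> K
    by standard (use iso pos K in \<open>auto simp: contact_isotopy_def\<close>)
  have \<phi>: "(\<lambda>q. \<Phi> (1, q)) = \<phi>" using end1 by blast
  have "\<exists>q. nontrivial_translated \<phi> k q" if k: "1 \<le> k" for k
  proof -
    obtain q r where "0 < r" "(\<phi> ^^ k) q = (fst q, fst (snd q), snd (snd q) + r)"
      "(\<Sum>m<k. gfun \<phi> ((\<phi> ^^ m) q)) = 0"
      using iterate_has_translated_point[unfolded \<phi>, OF ne k] by blast
    then have "nontrivial_translated \<phi> k q"
      using k unfolding nontrivial_translated_def translated_point_def contact_action_def
        gfun_iterate[OF assms(1)] by simp
    then show ?thesis by blast
  qed
  from infinitely_many_of_each[OF assms(1) this] show ?thesis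
    unfolding nontrivial_translated_def .
qed

end
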